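(* The algebra morphism $\bigoplus_{s\in S}\prod_{x\in X_s}(\tilde\varphi_{s,x}^\times)^*:\mathcal O_{hol}(\tilde C)\to\bigoplus_{s\in S}\prod_{x\in X_s}\mathcal O_{hol}(\tilde D^\times)$ is such that $$\Big(\bigoplus_{s\in S}\prod_{x\in X_s}(\tilde\varphi_{s,x}^\times)^*\Big)(F_\infty\mathcal O_{mod}(\tilde C))\subset\bigoplus_{s\in S}\prod_{x\in X_s}\mathcal O(D^\times)[e^*\log z].$$
   Context: $C$ is a smooth connected complex affine algebraic curve, also viewed as a Riemann surface; $p:\tilde C\to C$ is a universal cover; $\mathcal O_{hol}(M)$ is the algebra of holomorphic functions on a complex manifold $M$. $\Gamma_C:=\mathrm{Aut}(\tilde C/C)$ acts on the right on $\mathcal O_{hol}(\tilde C)$ by $f_{|\gamma}(x):=f(\gamma x)$, extended linearly to $\mathbb C\Gamma_C$; $(\mathbb C\Gamma_C)_+$ is the augmentation ideal. Let $\overline C$ be the smooth compactification of $C$, $S=\overline C\smallsetminus C$ (finite), $D=\{z\in\mathbb C\mid|z|<1\}$, $D^\times=D\smallsetminus\{0\}$, $\tilde D^\times=\{u\in\mathbb C\mid\Im u>0\}$, $e:\tilde D^\times\to D^\times$, $e(u)=\exp(2\pi\mathrm iu)$. $\mathcal O(D^\times)$ is the algebra of holomorphic functions $f$ on $D^\times$ such that $z^nf$ extends holomorphically to $D$ for some $n\ge0$, viewed inside $\mathcal O_{hol}(\tilde D^\times)$ via $e^*$; $e^*\log z$ denotes the function $u\mapsto2\pi\mathrm iu$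 on $\tilde D^\times$; $\mathcal O(D^\times)[e^*\log z]$ is the subalgebra of $\mathcal O_{hol}(\tilde D^\times)$ they generate. For each $s\in S$, $\varphi_s:D\to\overline C$ is an injective holomorphic map with $\varphi_s(0)=s$ and $\varphi_s(D)\cap S=\{s\}$; $X_s$ is the set of connected components of $p^{-1}(\varphi_s(D^\times))$; for $x\in X_s$, $\tilde\varphi^\times_{s,x}:\tilde D^\times\to\tilde C$ is a holomorphic map with image in the component $x$ and $p\circ\tilde\varphi^\times_{s,x}=\varphi_s\circ e$. $\mathcal O_{mod}(\tilde D^\times)$ is the set of $f\in\mathcal O_{hol}(\tilde D^\times)$ for which there are an integer $n>0$ and constants $C_{a,b}\ge0$ ($a\le b$ real) with $|f(x+\mathrm iy)|\le C_{a,b}e^{2\pi ny}$ for $x\in[a,b]$, $y>0$. $\mathcal O_{mod}(\tilde C)$ is the ($\Gamma_C$-stable) algebra of $f\in\mathcal O_{hol}(\tilde C)$ with $(\tilde\varphi_{s,x}^\times)^*f\in\mathcal O_{mod}(\tilde D^\times)$ for all $s\in S$, $x\in X_s$. $F_n\mathcal O_{mod}(\tilde C):=\{f\in\mathcal O_{mod}(\tilde C)\mid f_{|h}=0\ \forall h\in(\mathbb C\Gamma_C)_+^{n+1}\}$ and $F_\infty\mathcal O_{mod}(\tilde C):=\cup_{n\geq0}F_n\mathcal O_{mod}(\tilde C)$. *)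

theory Defs
  imports "HOL-Analysis.Analysis" "HOL-Algebra.Bij" "HOL-Algebra.Ideal_Product"
begin

section \<open>Riemann surfaces\<close>

text \<open>A Riemann surface is a subset of a Hausdorff type, with the subspace topology, together with
  an atlas of pairs \<open>(U, \<phi>)\<close>. Connectedness is not part of the definition. Atlases need not be
  maximal. Values of chart maps outside their domain are irrelevant.\<close>

type_synonym 'a atlas = "('a set \<times> ('a \<Rightarrow> complex)) set"

definition complex_chart :: "'a::topological_space set \<Rightarrow> 'a set \<Rightarrow> ('a \<Rightarrow> complex) \<Rightarrow> bool" where
  "complex_chart M U \<phi> \<longleftrightarrow>
     openin (top_of_set M) U \<and> open (\<phi> ` U) \<and> (\<exists>\<psi>. homeomorphism U (\<phi> ` U) \<phi> \<psi>)"

definition riemann_surface :: "'a::t2_space set \<Rightarrow> 'a atlas \<Rightarrow> bool" where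
  "riemann_surface M A \<longleftrightarrow>
     (\<forall>(U, \<phi>)\<in>A. complex_chart M U \<phi>) \<and> (\<Union>(U, \<phi>)\<in>A. U) = M \<and>
     (\<forall>(U, \<phi>)\<in>A. \<forall>(V, \<psi>)\<in>A. (\<psi> \<circ> inv_into U \<phi>) holomorphic_on \<phi> ` (U \<inter> V))"

definition plane_atlas :: "complex set \<Rightarrow> complex atlas" where
  "plane_atlas M = {(M, \<lambda>z. z)}"

definition holo_map ::
  "'a::topological_space set \<Rightarrow> 'a atlas \<Rightarrow> 'b::topological_space set \<Rightarrow> 'b atlas \<Rightarrow> ('a \<Rightarrow> 'b) \<Rightarrow> bool"
  where
  "holo_map M A N B f \<longleftrightarrow> f \<in> M \<rightarrow> N \<and> continuous_on M f \<and>
     (\<forall>(U, \<phi>)\<in>A. \<forall>(V, \<psi>)\<in>B. (\<psi> \<circ> f \<circ> inv_into U \<phi>) holomorphic_on \<phi> ` (U \<inter> f -` V))"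

text \<open>The algebra \<open>O_hol(M)\<close>; its operations are the pointwise ones on \<open>M\<close>. Functions are
  extensional, so that equality in \<open>O_hol(M)\<close> is equality on \<open>M\<close>.\<close>

definition hol_funs :: "'a set \<Rightarrow> 'a atlas \<Rightarrow> ('a \<Rightarrow> complex) set" where
  "hol_funs M A = {f \<in> extensional M. \<forall>(U, \<phi>)\<in>A. (f \<circ> inv_into U \<phi>) holomorphic_on \<phi> ` U}"

definition pullback :: "'a set \<Rightarrow> ('a \<Rightarrow> 'b) \<Rightarrow> ('b \<Rightarrow> complex) \<Rightarrow> 'a \<Rightarrow> complex" where
  "pullback M g f = (\<lambda>x\<in>M. f (g x))"

lemma riemann_surface_plane: "open M \<Longrightarrow> riemann_surface M (plane_atlas M)"
proof -
  assume "open M"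
  moreover have "(\<lambda>z. inv_into M (\<lambda>z. z) z) holomorphic_on M"
    by (rule holomorphic_transform[of "\<lambda>z. z"]) (auto simp: inv_into_f_f[of "\<lambda>z. z"])
  ultimately show ?thesis
    by (auto simp: riemann_surface_def plane_atlas_def complex_chart_def homeomorphism_def o_def
        intro!: exI[of _ "\<lambda>z. z"])
qed

lemma hol_funs_plane: "hol_funs M (plane_atlas M) = {f \<in> extensional M. f holomorphic_on M}"
proof -
  have "(\<lambda>z. f (inv_into M (\<lambda>z. z) z)) holomorphic_on M \<longleftrightarrow> f holomorphic_on M"
    for f :: "complex \<Rightarrow> complex"
    by (rule holomorphic_cong) (auto simp: inv_into_f_f[of "\<lambda>z. z"])
  then show ?thesis
    by (auto simp: hol_funs_def plane_atlas_def o_def)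
qed


text \<open>Pullback along a holomorphic map is a morphism of algebras \<open>O_hol(N) \<rightarrow> O_hol(M)\<close>.\<close>

lemma pullback_hol_funs:
  assumes M: "riemann_surface M A" and N: "riemann_surface N B"
    and g: "holo_map M A N B g" and f: "f \<in> hol_funs N B"
  shows "pullback M g f \<in> hol_funs M A"
proof -
  have "(pullback M g f \<circ> inv_into U \<phi>) holomorphic_on \<phi> ` U" if "(U, \<phi>) \<in> A" for U \<phi>
  proof -
    have U: "complex_chart M U \<phi>"
      using M that by (auto simp: riemann_surface_def)
    then have UM: "U \<subseteq> M" and oU: "open (\<phi> ` U)"
      by (auto simp: complex_chart_def dest: openin_imp_subset)
    obtain k where k: "homeomorphism U (\<phi> ` U) \<phi> k"
      using U by (auto simp: complex_chart_def)
    then have inv: "inv_into U \<phi> (\<phi> u) = u" if "u \<in> U" for u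
      using that by (intro inv_into_f_f) (auto simp: homeomorphism_def inj_on_def, metis)
    define W where "W V = \<phi> ` (U \<inter> g -` V)" for V
    have gM: "g \<in> M \<rightarrow> N" "continuous_on M g"
      using g by (auto simp: holo_map_def)
    have main: "open (W V) \<and> (pullback M g f \<circ> inv_into U \<phi>) holomorphic_on W V"
      if V: "(V, \<psi>) \<in> B" for V \<psi>
    proof
      have cV: "complex_chart N V \<psi>"
        using N V by (auto simp: riemann_surface_def)
      then have oV: "openin (top_of_set N) V"
        by (auto simp: complex_chart_def)
      obtain l where l: "homeomorphism V (\<psi> ` V) \<psi> l"
        using cV by (auto simp: complex_chart_def)
      then have invV: "inv_into V \<psi> (\<psi> v) = v" if "v \<in> V" for v
        using that by (intro inv_into_f_f) (auto simp: homeomorphism_def inj_on_def, metis)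
      have "openin (top_of_set M) (M \<inter> g -` V)"
        using continuous_openin_preimage[OF gM(2) gM(1) oV] .
      then have "openin (top_of_set U) (U \<inter> (M \<inter> g -` V))"
        using UM by (metis openin_subtopology_Int2 subtopology_subtopology inf.absorb_iff2)
      then have "openin (top_of_set U) (U \<inter> g -` V)"
        using UM by (simp add: Int_absorb2 flip: Int_assoc)
      then have "openin (top_of_set (\<phi> ` U)) (W V)"
        unfolding W_def using k homeomorphism_imp_open_map by blast
      then show "open (W V)"
        using oU openin_open_eq by blast
      have 1: "(\<psi> \<circ> g \<circ> inv_into U \<phi>) holomorphic_on W V"
        using g \<open>(U, \<phi>) \<in> A\<close> V by (auto simp: holo_map_def W_def)
      have 2: "(f \<circ> inv_into V \<psi>) holomorphic_on \<psi> ` V"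
        using f V by (auto simp: hol_funs_def)
      have "(f \<circ> inv_into V \<psi> \<circ> (\<psi> \<circ> g \<circ> inv_into U \<phi>)) holomorphic_on W V"
        by (rule holomorphic_on_compose_gen[OF 1 2]) (auto simp: W_def inv)
      then show "(pullback M g f \<circ> inv_into U \<phi>) holomorphic_on W V"
        by (rule holomorphic_transform) (use UM in \<open>auto simp: W_def inv invV pullback_def\<close>)
    qed
    have "\<phi> ` U = (\<Union>(V, \<psi>)\<in>B. W V)"
    proof -
      have "g u \<in> (\<Union>(V, \<psi>)\<in>B. V)" if "u \<in> U" for u
        using N gM(1) UM that by (auto simp: riemann_surface_def)
      then show ?thesis
        by (fastforce simp: W_def)
    qed
    then have "z \<in> \<phi> ` U \<Longrightarrow> (pullback M g f \<circ> inv_into U \<phi>) field_differentiable at z" for z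
      using main by (auto simp: holomorphic_on_def) (metis at_within_open)
    then show ?thesis
      by (auto simp: holomorphic_on_def intro: field_differentiable_at_within)
  qed
  then show ?thesis
    by (auto simp: hol_funs_def pullback_def)
qed

lemma pullback_algebra_morphism:
  assumes "g \<in> M \<rightarrow> N"
  shows "pullback M g (\<lambda>y\<in>N. c) = (\<lambda>x\<in>M. c)"
    and "pullback M g (\<lambda>y\<in>N. f1 y + f2 y) = (\<lambda>x\<in>M. pullback M g f1 x + pullback M g f2 x)"
    and "pullback M g (\<lambda>y\<in>N. f1 y * f2 y) = (\<lambda>x\<in>M. pullback M g f1 x * pullback M g f2 x)"
  using assms by (auto simp: pullback_def fun_eq_iff)


section \<open>Affine curves and their compactifications\<close>

inductive_set polynomial_funs :: "(complex ^ 'n \<Rightarrow> complex) set" where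
  const: "(\<lambda>x. c) \<in> polynomial_funs"
| coord: "(\<lambda>x. x $ i) \<in> polynomial_funs"
| add: "f \<in> polynomial_funs \<Longrightarrow> g \<in> polynomial_funs \<Longrightarrow> (\<lambda>x. f x + g x) \<in> polynomial_funs"
| mult: "f \<in> polynomial_funs \<Longrightarrow> g \<in> polynomial_funs \<Longrightarrow> (\<lambda>x. f x * g x) \<in> polynomial_funs"

definition algebraic_set :: "(complex ^ 'n) set \<Rightarrow> bool" where
  "algebraic_set Z \<longleftrightarrow> (\<exists>P \<subseteq> polynomial_funs. Z = {x. \<forall>f\<in>P. f x = 0})"

definition vanishing_ideal :: "(complex ^ 'n) set \<Rightarrow> (complex ^ 'n \<Rightarrow> complex) set" where
  "vanishing_ideal Z = {f \<in> polynomial_funs. \<forall>x\<in>Z. f x = 0}"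

definition zariski_tangent_space :: "(complex ^ 'n) set \<Rightarrow> complex ^ 'n \<Rightarrow> (complex ^ 'n) set" where
  "zariski_tangent_space Z x = {v. \<forall>f\<in>vanishing_ideal Z. deriv (\<lambda>t. f (x + t *s v)) 0 = 0}"

definition zariski_connected :: "(complex ^ 'n) set \<Rightarrow> bool" where
  "zariski_connected Z \<longleftrightarrow>
     (\<forall>Z1 Z2. algebraic_set Z1 \<and> algebraic_set Z2 \<and> Z = Z1 \<union> Z2 \<and> Z1 \<inter> Z2 = {} \<longrightarrow>
        Z1 = {} \<or> Z2 = {})"

text \<open>The tangent spaces are those of the reduced variety, so the last condition says both that \<open>C\<close>
  is smooth and that it has pure dimension one (an isolated point has tangent space \<open>{0}\<close>).\<close>

definition smooth_connected_affine_curve :: "(complex ^ 'n) set \<Rightarrow> bool" where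
  "smooth_connected_affine_curve C \<longleftrightarrow>
     algebraic_set C \<and> C \<noteq> {} \<and> zariski_connected C \<and>
     (\<forall>x\<in>C. vec.dim (zariski_tangent_space C x) = 1)"

text \<open>The complex structure of \<open>C\<close> as a submanifold of \<open>\<complex>\<^sup>n\<close>: charts are the inverses of
  the regular holomorphic parametrizations of open pieces of \<open>C\<close>.\<close>

definition affine_curve_atlas :: "(complex ^ 'n) set \<Rightarrow> (complex ^ 'n) atlas" where
  "affine_curve_atlas C = {(U, \<phi>). complex_chart C U \<phi> \<and>
     (\<forall>i. (\<lambda>z. inv_into U \<phi> z $ i) holomorphic_on \<phi> ` U) \<and>
     (\<forall>z\<in>\<phi> ` U. \<exists>i. deriv (\<lambda>w. inv_into U \<phi> w $ i) z \<noteq> 0)}"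

text \<open>The smooth compactification, as a Riemann surface: a compact Riemann surface containing \<open>C\<close>,
  via the open embedding \<open>j\<close>, as the complement of a finite set.
  It is determined by \<open>C\<close> up to unique isomorphism.\<close>

definition smooth_compactification ::
  "'a::topological_space set \<Rightarrow> 'a atlas \<Rightarrow> 'b::t2_space set \<Rightarrow> 'b atlas \<Rightarrow> ('a \<Rightarrow> 'b) \<Rightarrow> bool" where
  "smooth_compactification C A Cbar B j \<longleftrightarrow>
     riemann_surface Cbar B \<and> compact Cbar \<and> connected Cbar \<and>
     holo_map C A Cbar B j \<and> (\<exists>k. homeomorphism C (j ` C) j k) \<and>
     openin (top_of_set Cbar) (j ` C) \<and> finite (Cbar - j ` C)"


section \<open>Universal covers and deck transformations\<close>

definition universal_cover ::
  "'a::t2_space set \<Rightarrow> 'a atlas \<Rightarrow> 'b::topological_space set \<Rightarrow> 'b atlas \<Rightarrow> ('a \<Rightarrow> 'b) \<Rightarrow> bool" where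
  "universal_cover Ct At C A p \<longleftrightarrow>
     riemann_surface Ct At \<and> simply_connected Ct \<and> holo_map Ct At C A p \<and> covering_space Ct p C"

text \<open>\<open>Aut(Ct/C)\<close>, a subgroup of the group of all bijections of \<open>Ct\<close> (under composition).\<close>

definition deck_group ::
  "'a::topological_space set \<Rightarrow> 'a atlas \<Rightarrow> ('a \<Rightarrow> 'b) \<Rightarrow> ('a \<Rightarrow> 'a) monoid" where
  "deck_group Ct At p = BijGroup Ct \<lparr>carrier :=
     {\<gamma> \<in> Bij Ct. holo_map Ct At Ct At \<gamma> \<and> holo_map Ct At Ct At (inv_into Ct \<gamma>) \<and>
        (\<forall>y\<in>Ct. p (\<gamma> y) = p y)}\<rparr>"


section \<open>Group algebras\<close>

text \<open>The complex group algebra: finitely supported functions on the group with convolution.\<close>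

definition group_algebra :: "('g, 'm) monoid_scheme \<Rightarrow> ('g \<Rightarrow> complex) ring" where
  "group_algebra G =
     \<lparr>carrier = {a. finite {g. a g \<noteq> 0} \<and> {g. a g \<noteq> 0} \<subseteq> carrier G},
      mult = (\<lambda>a b g. if g \<in> carrier G
                       then \<Sum>h | a h \<noteq> 0. a h * b (inv\<^bsub>G\<^esub> h \<otimes>\<^bsub>G\<^esub> g) else 0),
      one = (\<lambda>g. if g = \<one>\<^bsub>G\<^esub> then 1 else 0),
      zero = (\<lambda>g. 0),
      add = (\<lambda>a b g. a g + b g)\<rparr>"

definition augmentation_ideal :: "('g, 'm) monoid_scheme \<Rightarrow> ('g \<Rightarrow> complex) set" where
  "augmentation_ideal G = {a \<in> carrier (group_algebra G). (\<Sum>g | a g \<noteq> 0. a g) = 0}"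

primrec ideal_power :: "('r, 'm) ring_scheme \<Rightarrow> 'r set \<Rightarrow> nat \<Rightarrow> 'r set" where
  "ideal_power R I 0 = carrier R"
| "ideal_power R I (Suc n) = ideal_prod R (ideal_power R I n) I"

text \<open>The right action \<open>f|a\<close>, linear in \<open>a\<close> and given on group elements by
  \<open>(f|\<gamma>)(x) = f (\<gamma> x)\<close>.\<close>

definition group_algebra_act ::
  "'a set \<Rightarrow> ('a \<Rightarrow> complex) \<Rightarrow> (('a \<Rightarrow> 'a) \<Rightarrow> complex) \<Rightarrow> 'a \<Rightarrow> complex" where
  "group_algebra_act M f a = (\<lambda>x\<in>M. \<Sum>\<gamma> | a \<gamma> \<noteq> 0. a \<gamma> * f (\<gamma> x))"


section \<open>The punctured disc and its universal cover\<close>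

abbreviation disc :: "complex set" where
  "disc \<equiv> ball 0 1"

abbreviation punctured_disc :: "complex set" where
  "punctured_disc \<equiv> disc - {0}"

definition upper_half_plane :: "complex set" where
  "upper_half_plane = {u. Im u > 0}"

definition expcov :: "complex \<Rightarrow> complex" where
  "expcov u = exp (2 * of_real pi * \<i> * u)"

definition meromorphic_disc_funs :: "(complex \<Rightarrow> complex) set" where
  "meromorphic_disc_funs = {f \<in> hol_funs punctured_disc (plane_atlas punctured_disc).
     \<exists>(n::nat) g. g holomorphic_on disc \<and> (\<forall>z\<in>punctured_disc. g z = z ^ n * f z)}"

inductive_set generated_subalgebra :: "'a set \<Rightarrow> ('a \<Rightarrow> complex) set \<Rightarrow> ('a \<Rightarrow> complex) set"
  for M :: "'a set" and G :: "('a \<Rightarrow> complex) set" where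
  gen: "f \<in> G \<Longrightarrow> f \<in> generated_subalgebra M G"
| const: "(\<lambda>x\<in>M. c) \<in> generated_subalgebra M G"
| add: "f \<in> generated_subalgebra M G \<Longrightarrow> g \<in> generated_subalgebra M G \<Longrightarrow>
        (\<lambda>x\<in>M. f x + g x) \<in> generated_subalgebra M G"
| mult: "f \<in> generated_subalgebra M G \<Longrightarrow> g \<in> generated_subalgebra M G \<Longrightarrow>
        (\<lambda>x\<in>M. f x * g x) \<in> generated_subalgebra M G"

text \<open>The algebra \<open>O(D\<^sup>\<times>)[e\<^sup>* log z]\<close>.\<close>

definition log_disc_funs :: "(complex \<Rightarrow> complex) set" where
  "log_disc_funs = generated_subalgebra upper_half_plane
     (insert (\<lambda>u\<in>upper_half_plane. 2 * of_real pi * \<i> * u)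
        (pullback upper_half_plane expcov ` meromorphic_disc_funs))"

definition moderate_half_plane_funs :: "(complex \<Rightarrow> complex) set" where
  "moderate_half_plane_funs = {f \<in> hol_funs upper_half_plane (plane_atlas upper_half_plane).
     \<exists>(n::nat) (K :: real \<Rightarrow> real \<Rightarrow> real). n > 0 \<and>
       (\<forall>a b. a \<le> b \<longrightarrow> K a b \<ge> 0 \<and>
          (\<forall>x\<in>{a..b}. \<forall>y>0. cmod (f (Complex x y)) \<le> K a b * exp (2 * pi * real n * y)))}"


section \<open>Moderate growth and the unipotent filtration\<close>

text \<open>Below, \<open>S\<close> is the set of punctures, \<open>X s\<close> the set of components over the puncture \<open>s\<close>, and
  \<open>\<phi>t s x\<close> the lift of the local parametrization at \<open>s\<close> to the component \<open>x\<close>.\<close>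

definition puncture_components ::
  "'a::topological_space set \<Rightarrow> ('a \<Rightarrow> 'b) \<Rightarrow> ('b \<Rightarrow> 'c) \<Rightarrow> (complex \<Rightarrow> 'c) \<Rightarrow> 'a set set" where
  "puncture_components Ct p j \<phi> = components {y \<in> Ct. j (p y) \<in> \<phi> ` punctured_disc}"

definition moderate_funs ::
  "'a set \<Rightarrow> 'a atlas \<Rightarrow> 's set \<Rightarrow> ('s \<Rightarrow> 'x set) \<Rightarrow> ('s \<Rightarrow> 'x \<Rightarrow> complex \<Rightarrow> 'a) \<Rightarrow> ('a \<Rightarrow> complex) set"
  where
  "moderate_funs Ct At S X \<phi>t = {f \<in> hol_funs Ct At.
     \<forall>s\<in>S. \<forall>x\<in>X s. pullback upper_half_plane (\<phi>t s x) f \<in> moderate_half_plane_funs}"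

definition filtration_moderate ::
  "'a::topological_space set \<Rightarrow> 'a atlas \<Rightarrow> ('a \<Rightarrow> 'b) \<Rightarrow> 's set \<Rightarrow> ('s \<Rightarrow> 'x set) \<Rightarrow>
     ('s \<Rightarrow> 'x \<Rightarrow> complex \<Rightarrow> 'a) \<Rightarrow> nat \<Rightarrow> ('a \<Rightarrow> complex) set" where
  "filtration_moderate Ct At p S X \<phi>t n = {f \<in> moderate_funs Ct At S X \<phi>t.
     \<forall>h \<in> ideal_power (group_algebra (deck_group Ct At p))
                       (augmentation_ideal (deck_group Ct At p)) (n + 1).
       group_algebra_act Ct f h = (\<lambda>x\<in>Ct. 0)}"

definition filtration_moderate_infinity ::
  "'a::topological_space set \<Rightarrow> 'a atlas \<Rightarrow> ('a \<Rightarrow> 'b) \<Rightarrow> 's set \<Rightarrow> ('s \<Rightarrow> 'x set) \<Rightarrow>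
     ('s \<Rightarrow> 'x \<Rightarrow> complex \<Rightarrow> 'a) \<Rightarrow> ('a \<Rightarrow> complex) set" where
  "filtration_moderate_infinity Ct At p S X \<phi>t = (\<Union>n. filtration_moderate Ct At p S X \<phi>t n)"

text \<open>Since \<open>S\<close> is finite, the direct sum over \<open>S\<close> is the product.\<close>

definition puncture_pullback ::
  "'s set \<Rightarrow> ('s \<Rightarrow> 'x set) \<Rightarrow> ('s \<Rightarrow> 'x \<Rightarrow> complex \<Rightarrow> 'a) \<Rightarrow> ('a \<Rightarrow> complex) \<Rightarrow>
     's \<Rightarrow> 'x \<Rightarrow> complex \<Rightarrow> complex" where
  "puncture_pullback S X \<phi>t f = (\<lambda>s\<in>S. \<lambda>x\<in>X s. pullback upper_half_plane (\<phi>t s x) f)"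

end

theory Submission
  imports Defs "HOL-Complex_Analysis.Complex_Singularities"
begin

text \<open>Let \<open>\<psi>\<close> be the lift of a punctured disc to \<open>x\<close>. Since \<open>\<psi>(u)\<close> and \<open>\<psi>(u + 1)\<close> lie over the same point
  of \<open>C\<close>, there is a deck transformation \<open>\<gamma>\<close> with \<open>\<gamma> \<circ> \<psi> = \<psi>(\<cdot> + 1)\<close>. For \<open>f\<close> in the \<open>n\<close>-th filtration
  step, the element \<open>(\<gamma> - 1)\<^sup>n\<^sup>+\<^sup>1\<close> kills \<open>f\<close>, so the \<open>(n + 1)\<close>-st difference of \<open>g = f \<circ> \<psi>\<close> vanishes.
  The \<open>n\<close>-th difference of \<open>g\<close> is then periodic and of moderate growth, hence a meromorphic function of
  \<open>exp(2\<pi>iu)\<close>. Subtracting \<open>u gchoose n\<close> times it from \<open>g\<close> leaves a function whose \<open>n\<close>-th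
  difference vanishes, and induction gives the claim.

  The deck transformation comes from path lifting, and it is holomorphic because the covering map is a local
  biholomorphism. This needs charts of \<open>C\<close> around every point, which come from the inverse function theorem
  at a smooth point.\<close>

section \<open>Coverings by simply connected spaces\<close>

text \<open>The space \<open>Ct\<close> is only assumed Hausdorff, so lifts are built by bisecting
  the square upstairs from the plane and compared through the closed diagonal; no metric on
  \<open>Ct\<close> enters. The atlas \<open>affine_curve_atlas C\<close> consists of all regular
  parametrizations, but nothing in its definition says that their domains cover \<open>C\<close>;
  this must be extracted from the algebraic tangent spaces. The equations make a coordinate
  injective near a smooth point, while openness of its image is a statement about dimension, and is
  read off the compactification. One \<gamma> must serve for all u: it is chosen at the single point
  \<open>\<i>\<close>, and uniqueness of lifts on the connected half-plane does the rest. Right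
  multiplication by \<gamma> - 1 shifts the point of evaluation, since (h\<gamma>)(x) =
  h(\<gamma>(x)); hence powers of \<gamma> - 1 become iterated differences although the group need
  not be commutative. The factor \<open>u gchoose n\<close> is the discrete analogue of u^n/n!: its
  n-th difference is 1, and multiplication by a periodic function commutes with differences.\<close>

lemma covering_lift_unique:
  fixes g1 g2 :: "'a::topological_space \<Rightarrow> 'b::t2_space"
  assumes cov: "covering_space E p B" and conn: "connected T" and a: "a \<in> T" "g1 a = g2 a"
    and g1: "continuous_on T g1" "g1 \<in> T \<rightarrow> E"
    and g2: "continuous_on T g2" "g2 \<in> T \<rightarrow> E"
    and eq: "\<And>x. x \<in> T \<Longrightarrow> p (g1 x) = p (g2 x)" and x: "x \<in> T"
  shows "g1 x = g2 x"
proof -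
  define G where "G = {x\<in>T. g1 x = g2 x}"
  \<comment> \<open>Hausdorffness of the total space enters here: the set of agreement is the
    preimage of the closed diagonal.\<close>
  have "closedin (top_of_set T) (T \<inter> (\<lambda>x. (g1 x, g2 x)) -` {y. \<exists>x. y = (x, x)})"
    by (intro continuous_closedin_preimage closed_diagonal continuous_intros g1 g2)
  then have "closedin (top_of_set T) G"
    by (rule back_subst[of "closedin _"]) (auto simp: G_def)
  moreover have "openin (top_of_set T) G"
  proof (subst openin_subopen, intro ballI)
    fix z assume z: "z \<in> G"
    then have "g1 z \<in> E" using g1(2) unfolding G_def by blast
    then obtain v w q where v: "g1 z \<in> v" "openin (top_of_set E) v" "homeomorphism v w p q"
      using covering_space_local_homeomorphism[OF cov] by metis
    \<comment> \<open>Near \<open>z\<close> both maps stay in the one sheet \<open>v\<close>, on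
      which \<open>p\<close> is injective, so equal projections force equal values.\<close>
    have "openin (top_of_set T) ((T \<inter> g1 -` v) \<inter> (T \<inter> g2 -` v))"
      by (intro openin_Int continuous_openin_preimage[OF g1 v(2)] continuous_openin_preimage[OF g2 v(2)])
    moreover have "z \<in> (T \<inter> g1 -` v) \<inter> (T \<inter> g2 -` v)"
      using z v(1) by (auto simp: G_def)
    moreover have "(T \<inter> g1 -` v) \<inter> (T \<inter> g2 -` v) \<subseteq> G"
    proof clarify
      fix x assume x: "x \<in> T" "g1 x \<in> v" "g2 x \<in> v"
      then have "q (p (g1 x)) = g1 x" "q (p (g2 x)) = g2 x"
        using homeomorphism_apply1[OF v(3)] by auto
      then have "g1 x = g2 x" using eq[OF x(1)] by metis
      then show "x \<in> G" using x(1) by (simp add: G_def)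
    qed
    ultimately show "\<exists>W. openin (top_of_set T) W \<and> z \<in> W \<and> W \<subseteq> G" by blast
  qed
  ultimately have "G = {} \<or> G = T"
    using conn connected_clopen by blast
  then show ?thesis using a x by (auto simp: G_def)
qed

text \<open>Quantifying over every base point \<open>z\<close> and every \<open>y\<close> above it
  prepares for gluing: a lift over a second piece can start from whatever value the first lift has
  reached.\<close>

definition lifts_on ::
  "'b set \<Rightarrow> ('b::topological_space \<Rightarrow> 'c) \<Rightarrow> ('a::topological_space \<Rightarrow> 'c) \<Rightarrow> 'a set \<Rightarrow> bool" where
  "lifts_on E p f A \<longleftrightarrow> (\<forall>z\<in>A. \<forall>y\<in>E. p y = f z \<longrightarrow>
     (\<exists>g. continuous_on A g \<and> g \<in> A \<rightarrow> E \<and> (\<forall>x\<in>A. p (g x) = f x) \<and> g z = y))"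

lemma lifts_on_evenly_covered:
  assumes p: "\<Union>v = E \<inter> p -` T" "\<forall>u\<in>v. \<exists>q. homeomorphism u T p q"
    and f: "continuous_on A f" "f \<in> A \<rightarrow> T"
  shows "lifts_on E p f A"
  unfolding lifts_on_def
proof (intro ballI impI)
  fix z y assume z: "z \<in> A" "y \<in> E" "p y = f z"
  then have "y \<in> E \<inter> p -` T" using f by auto
  then obtain u where u: "u \<in> v" "y \<in> u" using p(1) by blast
  then obtain q where q: "homeomorphism u T p q" using p(2) by blast
  have im: "q t \<in> u" if "t \<in> T" for t
    using homeomorphism_image2[OF q] that by blast
  have "continuous_on A (q \<circ> f)"
    using f homeomorphism_cont2[OF q] by (intro continuous_on_compose) (auto elim: continuous_on_subset)
  moreover have "(q \<circ> f) \<in> A \<rightarrow> E"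
    using f(2) im u(1) p(1) by fastforce
  moreover have "\<forall>x\<in>A. p ((q \<circ> f) x) = f x"
    using f(2) homeomorphism_apply2[OF q] by auto
  moreover have "(q \<circ> f) z = y"
    using homeomorphism_apply1[OF q u(2)] z(3) by simp
  ultimately show "\<exists>g. continuous_on A g \<and> g \<in> A \<rightarrow> E \<and> (\<forall>x\<in>A. p (g x) = f x) \<and> g z = y"
    by blast
qed

text \<open>Lift over one set, then over the other, starting from the value at a common point. The
  overlap is connected, so the two lifts agree on all of it, and closedness of both sets makes the
  pasted map continuous.\<close>

lemma lifts_on_Un:
  fixes p :: "'b::t2_space \<Rightarrow> 'c::topological_space"
  assumes cov: "covering_space E p B" and AB: "closed A" "closed B'" "connected (A \<inter> B')" "A \<inter> B' \<noteq> {}"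
    and l: "lifts_on E p f A" "lifts_on E p f B'"
  shows "lifts_on E p f (A \<union> B')"
proof -
  \<comment> \<open>Proved for an arbitrary pair of sets, because the lift has to start on the side
    that contains the base point, and this may be either one.\<close>
  have *: "\<exists>g. continuous_on (A \<union> B') g \<and> g \<in> A \<union> B' \<rightarrow> E \<and> (\<forall>x\<in>A \<union> B'. p (g x) = f x) \<and> g z = y"
    if AB: "closed A" "closed B'" "connected (A \<inter> B')" "A \<inter> B' \<noteq> {}"
      and l: "lifts_on E p f A" "lifts_on E p f B'" and z: "z \<in> A" "y \<in> E" "p y = f z" for A B' z y
  proof -
    obtain g1 where g1: "continuous_on A g1" "g1 \<in> A \<rightarrow> E" "\<And>x. x \<in> A \<Longrightarrow> p (g1 x) = f x" "g1 z = y"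
      using l(1) z unfolding lifts_on_def by meson
    obtain w where w: "w \<in> A \<inter> B'" using AB(4) by blast
    obtain g2 where g2: "continuous_on B' g2" "g2 \<in> B' \<rightarrow> E" "\<And>x. x \<in> B' \<Longrightarrow> p (g2 x) = f x" "g2 w = g1 w"
      using l(2) w g1 unfolding lifts_on_def by (metis IntD1 IntD2 PiE)
    have eq: "g1 x = g2 x" if "x \<in> A \<inter> B'" for x
      by (rule covering_lift_unique[OF cov AB(3) w _ _ _ _ _ _ that])
         (use g1 g2 in \<open>auto intro: continuous_on_subset\<close>)
    define g where "g x = (if x \<in> A then g1 x else g2 x)" for x
    have "continuous_on (A \<union> B') g"
      unfolding g_def by (rule continuous_on_cases) (use AB g1 g2 eq in auto)
    moreover have "g \<in> A \<union> B' \<rightarrow> E" "\<forall>x\<in>A \<union> B'. p (g x) = f x" "g z = y"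
      using g1 g2 z by (auto simp: g_def)
    ultimately show ?thesis by blast
  qed
  show ?thesis
    unfolding lifts_on_def
  proof (intro ballI impI)
    fix z y assume z: "z \<in> A \<union> B'" "y \<in> E" "p y = f z"
    show "\<exists>g. continuous_on (A \<union> B') g \<and> g \<in> A \<union> B' \<rightarrow> E \<and> (\<forall>x\<in>A \<union> B'. p (g x) = f x) \<and> g z = y"
    proof (cases "z \<in> A")
      case True
      then show ?thesis using *[OF AB l True z(2,3)] by simp
    next
      case False
      then have "z \<in> B'" using z(1) by blast
      then show ?thesis
        using *[OF AB(2,1) _ _ l(2,1) _ z(2,3)] AB(3,4) by (simp add: Int_commute Un_commute)
    qed
  qed
qed

text \<open>Bisection in each coordinate stands in for a Lebesgue number: adjacent rectangles meet
  in a segment, which is connected, so \<open>lifts_on_Un\<close> glues them. The map lives on the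
  whole plane because the local case of \<open>Bolzano\<close> also speaks of intervals that stick
  out of the given one.\<close>

lemma lifts_on_rectangle:
  fixes p :: "'b::t2_space \<Rightarrow> 'c::topological_space" and f :: "real \<times> real \<Rightarrow> 'c"
  assumes cov: "covering_space E p B" and f: "continuous_on UNIV f" "range f \<subseteq> B"
    and le: "a \<le> b" "c \<le> d"
  shows "lifts_on E p f ({a..b} \<times> {c..d})"
  using le(1)
proof (induction a b rule: Bolzano)
  case (trans a m b)
  have eq: "{a..m} \<times> {c..d} \<union> {m..b} \<times> {c..d} = {a..b} \<times> {c..d}"
    "({a..m} \<times> {c..d}) \<inter> ({m..b} \<times> {c..d}) = {m} \<times> {c..d}"
    using trans by auto
  have "lifts_on E p f ({a..m} \<times> {c..d} \<union> {m..b} \<times> {c..d})"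
    using le(2) by (intro lifts_on_Un[OF cov] trans closed_Times) (auto simp: eq intro!: connected_Times)
  then show ?case by (simp add: eq)
next
  \<comment> \<open>A second bisection, in the other coordinate, shows that a thin enough strip
    around \<open>x\<close> lifts over all of \<open>{c..d}\<close>. The choice of the width is part
    of the statement being bisected, so gluing takes the smaller of two widths.\<close>
  case (local x)
  show ?case
    using le(2)
  proof (induction c d rule: Bolzano)
    case (trans c m d)
    obtain d1 d2 where d: "d1 > 0" "d2 > 0"
      "\<And>a b. a \<le> x \<Longrightarrow> x \<le> b \<Longrightarrow> b - a < d1 \<Longrightarrow> lifts_on E p f ({a..b} \<times> {c..m})"
      "\<And>a b. a \<le> x \<Longrightarrow> x \<le> b \<Longrightarrow> b - a < d2 \<Longrightarrow> lifts_on E p f ({a..b} \<times> {m..d})"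
      using trans(1,2) by meson
    have "lifts_on E p f ({a..b} \<times> {c..d})" if ab: "a \<le> x" "x \<le> b" "b - a < min d1 d2" for a b
    proof -
      have eq: "{a..b} \<times> {c..m} \<union> {a..b} \<times> {m..d} = {a..b} \<times> {c..d}"
        "({a..b} \<times> {c..m}) \<inter> ({a..b} \<times> {m..d}) = {a..b} \<times> {m}"
        using trans by auto
      have "lifts_on E p f ({a..b} \<times> {c..m} \<union> {a..b} \<times> {m..d})"
        using ab by (intro lifts_on_Un[OF cov] d closed_Times) (auto simp: eq intro!: connected_Times)
      then show ?thesis by (simp add: eq)
    qed
    then show ?case using d(1,2) by (intro exI[of _ "min d1 d2"]) auto
  next
    case (local y)
    have "f (x, y) \<in> B" using f(2) by auto
    then obtain T v where T: "f (x, y) \<in> T" "openin (top_of_set B) T" "\<Union>v = E \<inter> p -` T"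
      "\<forall>u\<in>v. \<exists>q. homeomorphism u T p q"
      using cov unfolding covering_space_def by metis
    have "openin (top_of_set UNIV) (UNIV \<inter> f -` T)"
      by (rule continuous_openin_preimage[OF f(1) _ T(2)]) (use f(2) in auto)
    then have "open (f -` T)" by simp
    then obtain A1 A2 where A: "open A1" "open A2" "x \<in> A1" "y \<in> A2" "A1 \<times> A2 \<subseteq> f -` T"
      using T(1) by (metis open_prod_elim mem_Sigma_iff vimage_eq)
    obtain e1 e2 where e: "e1 > 0" "e2 > 0" "ball x e1 \<subseteq> A1" "ball y e2 \<subseteq> A2"
      using A by (meson open_contains_ball)
    have "lifts_on E p f ({a..b} \<times> {c..d})"
      if "a \<le> x" "x \<le> b" "b - a < e1" "c \<le> y" "y \<le> d" "d - c < e2" for a b c d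
    proof (rule lifts_on_evenly_covered[OF T(3,4)])
      have "{a..b} \<subseteq> ball x e1" "{c..d} \<subseteq> ball y e2"
        using that by (auto simp: dist_real_def)
      then show "f \<in> {a..b} \<times> {c..d} \<rightarrow> T"
        using e A by fastforce
    qed (use f in \<open>auto elim: continuous_on_subset\<close>)
    then show ?case
      using e by (intro exI[of _ e2]) (auto intro!: exI[of _ e1])
  qed
qed

lemma covering_lift_square:
  fixes p :: "'b::t2_space \<Rightarrow> 'c::topological_space" and h :: "real \<times> real \<Rightarrow> 'c"
  assumes cov: "covering_space E p B" and h: "continuous_on ({0..1} \<times> {0..1}) h" "h \<in> {0..1} \<times> {0..1} \<rightarrow> B"
    and z: "z \<in> {0..1} \<times> {0..1}" and y: "y \<in> E" "p y = h z"
  obtains g where "continuous_on ({0..1} \<times> {0..1}) g" "g \<in> {0..1} \<times> {0..1} \<rightarrow> E"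
    "\<And>x. x \<in> {0..1} \<times> {0..1} \<Longrightarrow> p (g x) = h x" "g z = y"
proof -
  \<comment> \<open>Clamping to the unit interval extends \<open>h\<close> to the whole plane, as
    \<open>lifts_on_rectangle\<close> requires, without leaving \<open>B\<close>.\<close>
  define k :: "real \<Rightarrow> real" where "k s = max 0 (min 1 s)" for s
  define f where "f u = h (k (fst u), k (snd u))" for u
  have k: "continuous_on UNIV k" unfolding k_def by (intro continuous_intros)
  have kim: "k s \<in> {0..1}" for s by (auto simp: k_def)
  have "continuous_on UNIV (h \<circ> (\<lambda>u. (k (fst u), k (snd u))))"
  proof (rule continuous_on_compose)
    show "continuous_on UNIV (\<lambda>u. (k (fst u), k (snd u)))"
      by (intro continuous_intros continuous_on_compose2[OF k]) auto
  qed (use kim in \<open>auto intro!: continuous_on_subset[OF h(1)]\<close>)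
  then have f1: "continuous_on UNIV f" by (simp add: f_def[abs_def] o_def)
  have f2: "range f \<subseteq> B" using h(2) kim by (auto simp: f_def)
  have kid: "k s = s" if "s \<in> {0..1}" for s using that by (auto simp: k_def)
  have fh: "f x = h x" if "x \<in> {0..1} \<times> {0..1}" for x
    using that kid by (auto simp: f_def)
  have "lifts_on E p f ({0..1} \<times> {0..1})"
    by (rule lifts_on_rectangle[OF cov f1 f2]) auto
  moreover have "p y = f z" using y(2) fh[OF z] by simp
  ultimately have "\<exists>g. continuous_on ({0..1} \<times> {0..1}) g \<and> g \<in> {0..1} \<times> {0..1} \<rightarrow> E \<and>
    (\<forall>x\<in>{0..1} \<times> {0..1}. p (g x) = f x) \<and> g z = y"
    using z y(1) unfolding lifts_on_def by blast
  then obtain g where g: "continuous_on ({0..1} \<times> {0..1}) g" "g \<in> {0..1} \<times> {0..1} \<rightarrow> E"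
    "\<forall>x\<in>{0..1} \<times> {0..1}. p (g x) = f x" "g z = y"
    by (elim exE conjE)
  show thesis
  proof (rule that[OF g(1,2) _ g(4)])
    show "p (g x) = h x" if "x \<in> {0..1} \<times> {0..1}" for x
      using g(3) fh[OF that] that by auto
  qed
qed

lemma covering_lift_path:
  fixes p :: "'b::t2_space \<Rightarrow> 'c::topological_space"
  assumes cov: "covering_space E p B" and r: "path r" "path_image r \<subseteq> B"
    and y: "y \<in> E" "p y = r 0"
  obtains k where "path k" "path_image k \<subseteq> E" "k 0 = y" "\<And>t. t \<in> {0..1} \<Longrightarrow> p (k t) = r t"
proof -
  \<comment> \<open>A path is treated as a square that is constant in its first coordinate.\<close>
  have c: "continuous_on ({0..1} \<times> {0..1}) (r \<circ> snd)"
    using r by (intro continuous_on_compose continuous_intros) (auto simp: path_def)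
  have rB: "r \<circ> snd \<in> {0..1} \<times> {0..1} \<rightarrow> B"
    using r(2) by (auto simp: path_image_def)
  have z: "(0, 0) \<in> {0..1::real} \<times> {0..1::real}" and y0: "p y = (r \<circ> snd) (0, 0)"
    using y by auto
  obtain g where g: "continuous_on ({0..1} \<times> {0..1}) g" "g \<in> {0..1} \<times> {0..1} \<rightarrow> E"
    "\<And>x. x \<in> {0..1::real} \<times> {0..1} \<Longrightarrow> p (g x) = (r \<circ> snd) x" "g (0, 0) = y"
    by (rule covering_lift_square[OF cov c rB z y(1) y0], rule that)
  show thesis
  proof (rule that[of "\<lambda>t. g (0, t)"])
    show "path (\<lambda>t. g (0, t))"
      unfolding path_def by (rule continuous_on_compose2[OF g(1)]) (auto intro!: continuous_intros)
    show "path_image (\<lambda>t. g (0, t)) \<subseteq> E"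
      using g(2) by (auto simp: path_image_def)
    show "p (g (0, t)) = r t" if "t \<in> {0..1}" for t
      using g(3)[of "(0, t)"] that by auto
  qed (use g in auto)
qed

section \<open>Monodromy in a simply connected total space\<close>

lemma simply_connectedD:
  assumes "simply_connected E" "path r" "pathfinish r = pathstart r" "path_image r \<subseteq> E"
    "path q" "pathfinish q = pathstart q" "path_image q \<subseteq> E"
  shows "homotopic_loops E r q"
  using assms(1)[unfolded simply_connected_def, rule_format, of r q] assms(2-) by blast

text \<open>Simple connectedness compares any two loops by free homotopy, in particular two constant
  ones. The trace of one parameter value under such a homotopy is the required path.\<close>

lemma simply_connected_path_between:
  assumes "simply_connected E" "a \<in> E" "b \<in> E"
  obtains r where "path r" "path_image r \<subseteq> E" "r 0 = a" "r 1 = b"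
proof -
  have "homotopic_loops E (\<lambda>_. a) (\<lambda>_. b)"
    using assms(2,3) by (intro simply_connectedD[OF assms(1)])
      (auto simp: path_def path_image_def pathstart_def pathfinish_def)
  then obtain h where h: "continuous_on ({0..1::real} \<times> {0..1}) h" "h \<in> ({0..1} \<times> {0..1}) \<rightarrow> E"
    "\<forall>x\<in>{0..1::real}. h (0, x) = a" "\<forall>x\<in>{0..1::real}. h (1, x) = b"
    unfolding homotopic_loops by auto
  show thesis
  proof (rule that[of "\<lambda>s. h (s, 0)"])
    show "path (\<lambda>s. h (s, 0))"
      unfolding path_def by (rule continuous_on_compose2[OF h(1)]) (auto intro!: continuous_intros)
  qed (use h in \<open>auto simp: path_image_def\<close>)
qed

text \<open>A free homotopy from the loop to a constant one suffices: the two vertical sides of the lifted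
  square are lifts of the same path that agree at their ends.\<close>

lemma simply_connected_loop_lift_closed:
  fixes p :: "'b::t2_space \<Rightarrow> 'c::topological_space"
  assumes cov: "covering_space E p B" and sc: "simply_connected E"
    and l: "path l" "path_image l \<subseteq> E" "l 0 = l 1"
    and m: "path m" "path_image m \<subseteq> E" "\<And>t. t \<in> {0..1} \<Longrightarrow> p (m t) = p (l t)"
  shows "m 0 = m 1"
proof -
  have l0: "l 0 \<in> E" using l(2) by (auto simp: path_image_def)
  have "homotopic_loops E l (\<lambda>_. l 0)"
    using l l0 by (intro simply_connectedD[OF sc])
      (auto simp: path_def path_image_def pathstart_def pathfinish_def)
  then obtain h where h: "continuous_on ({0..1::real} \<times> {0..1}) h" "h \<in> ({0..1} \<times> {0..1}) \<rightarrow> E"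
    "\<And>x. x \<in> {0..1::real} \<Longrightarrow> h (0, x) = l x" "\<And>x. x \<in> {0..1::real} \<Longrightarrow> h (1, x) = l 0"
    "\<And>t. t \<in> {0..1::real} \<Longrightarrow> h (t, 1) = h (t, 0)"
    unfolding homotopic_loops by (auto simp: pathfinish_def pathstart_def)
  have p: "continuous_on E p" "p ` E = B"
    using cov by (auto simp: covering_space_def)
  have ph: "continuous_on ({0..1} \<times> {0..1}) (p \<circ> h)" "(p \<circ> h) \<in> {0..1} \<times> {0..1} \<rightarrow> B"
    using h(1,2) p by (auto intro!: continuous_on_compose2[OF p(1) h(1)])
  have m0: "m 0 \<in> E" using m(2) by (auto simp: path_image_def)
  have z: "(0, 0) \<in> {0..1::real} \<times> {0..1::real}" and pm0: "p (m 0) = (p \<circ> h) (0, 0)"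
    using m(3)[of 0] h(3)[of 0] by auto
  obtain K where K: "continuous_on ({0..1} \<times> {0..1}) K" "K \<in> {0..1} \<times> {0..1} \<rightarrow> E"
    "\<And>x. x \<in> {0..1} \<times> {0..1} \<Longrightarrow> p (K x) = (p \<circ> h) x" "K (0, 0) = m 0"
    by (rule covering_lift_square[OF cov ph z m0 pm0], rule that)
  have col: "continuous_on {0..1} (\<lambda>s. K (s, c))" "(\<lambda>s. K (s, c)) \<in> {0..1} \<rightarrow> E"
    if "c \<in> {0..1}" for c
    using that K(2) by (auto intro!: continuous_on_compose2[OF K(1)] continuous_intros)
  have row: "continuous_on {0..1} (\<lambda>t. K (c, t))" "(\<lambda>t. K (c, t)) \<in> {0..1} \<rightarrow> E"
    if "c \<in> {0..1}" for c
    using that K(2) by (auto intro!: continuous_on_compose2[OF K(1)] continuous_intros)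
  \<comment> \<open>The homotopy ends in a constant loop, so this edge of the lifted square lies
    over a single point and is constant. This provides the common end of the two sides compared
    next.\<close>
  have K1: "K (1, 1) = K (1, 0)"
  proof (rule covering_lift_unique[OF cov, of "{0..1::real}" 0 "\<lambda>t. K (1, t)" "\<lambda>t. K (1, 0)" 1])
    show "(\<lambda>t. K (1, 0)) \<in> {0..1} \<rightarrow> E"
      using K(2) by auto
    show "p (K (1, t)) = p (K (1, 0))" if "t \<in> {0..1}" for t
      using K(3)[of "(1, t)"] K(3)[of "(1, 0)"] h(4) that by auto
  qed (use row[of 1] in auto)
  have "K (0, 1) = K (0, 0)"
  proof (rule covering_lift_unique[OF cov, of "{0..1::real}" 1 "\<lambda>s. K (s, 1)" "\<lambda>s. K (s, 0)" 0])
    show "p (K (s, 1)) = p (K (s, 0))" if "s \<in> {0..1}" for s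
      using K(3)[of "(s, 1)"] K(3)[of "(s, 0)"] h(5) that by auto
  qed (use col[of 0] col[of 1] K1 in auto)
  moreover have "K (0, 1) = m 1"
  proof (rule covering_lift_unique[OF cov, of "{0..1::real}" 0 "\<lambda>t. K (0, t)" m 1])
    show "p (K (0, t)) = p (m t)" if "t \<in> {0..1}" for t
      using K(3)[of "(0, t)"] h(3) m(3) that by auto
    show "m \<in> {0..1} \<rightarrow> E"
      using m(2) by (auto simp: path_image_def)
  qed (use row[of 0] K(4) m(1) in \<open>auto simp: path_def\<close>)
  ultimately show ?thesis using K(4) by simp
qed

text \<open>The value at \<open>y\<close> is the end of the lift, started at \<open>b\<close>, of
  the projection of any path from \<open>a\<close> to \<open>y\<close>. Simple connectedness makes
  it independent of the path, and local path connectedness makes it continuous.\<close>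

lemma covering_deck_map_exists:
  fixes p :: "'b::t2_space \<Rightarrow> 'c::topological_space"
  assumes cov: "covering_space E p B" and sc: "simply_connected E" and lpc: "locally path_connected E"
    and a: "a \<in> E" and b: "b \<in> E" and ab: "p a = p b"
  obtains \<gamma> where "continuous_on E \<gamma>" "\<gamma> \<in> E \<rightarrow> E" "\<And>y. y \<in> E \<Longrightarrow> p (\<gamma> y) = p y" "\<gamma> a = b"
proof -
  have p: "continuous_on E p" "p ` E = B"
    using cov by (auto simp: covering_space_def)
  \<comment> \<open>The pair (\<open>r\<close>, \<open>k\<close>) witnesses that \<open>w\<close> is
    the end of the lift: both paths have the same projection, one starting at \<open>a\<close>, the
    other at \<open>b\<close>.\<close>
  define R where "R y w \<longleftrightarrow> (\<exists>r k. path r \<and> path_image r \<subseteq> E \<and> r 0 = a \<and> r 1 = y \<and>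
    path k \<and> path_image k \<subseteq> E \<and> k 0 = b \<and> k 1 = w \<and> (\<forall>t\<in>{0..1}. p (k t) = p (r t)))" for y w
  have lift: "\<exists>k. path k \<and> path_image k \<subseteq> E \<and> k 0 = b \<and> (\<forall>t\<in>{0..1}. p (k t) = p (r t))"
    if r: "path r" "path_image r \<subseteq> E" "r 0 = a" for r
  proof -
    have "path (p \<circ> r)"
      using r p(1) by (intro path_continuous_image) (auto elim: continuous_on_subset)
    moreover have "path_image (p \<circ> r) \<subseteq> B"
      using r(2) p(2) by (auto simp: path_image_def)
    moreover have "p b = (p \<circ> r) 0" using ab r(3) by simp
    ultimately show ?thesis
      using covering_lift_path[OF cov _ _ b, of "p \<circ> r"] by (metis comp_apply)
  qed
  have ex: "\<exists>w. R y w" if y: "y \<in> E" for y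
  proof -
    obtain r where r: "path r" "path_image r \<subseteq> E" "r 0 = a" "r 1 = y"
      using simply_connected_path_between[OF sc a y] .
    then show ?thesis using lift[OF r(1-3)] unfolding R_def by metis
  qed
  have in_image: "h t \<in> E" if "path_image h \<subseteq> E" "t \<in> {0..1}" for h :: "real \<Rightarrow> 'b" and t
    using that by (auto simp: path_image_def)
  have unique: "w = w'" if "R y w" "R y w'" for y w w'
  proof -
    obtain r k where r: "path r" "path_image r \<subseteq> E" "r 0 = a" "r 1 = y" and
      k: "path k" "path_image k \<subseteq> E" "k 0 = b" "k 1 = w" "\<And>t. t \<in> {0..1} \<Longrightarrow> p (k t) = p (r t)"
      using \<open>R y w\<close> unfolding R_def by blast
    obtain r' k' where r': "path r'" "path_image r' \<subseteq> E" "r' 0 = a" "r' 1 = y" and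
      k': "path k'" "path_image k' \<subseteq> E" "k' 0 = b" "k' 1 = w'" "\<And>t. t \<in> {0..1} \<Longrightarrow> p (k' t) = p (r' t)"
      using \<open>R y w'\<close> unfolding R_def by blast
    \<comment> \<open>The projection of this loop lifts from \<open>b\<close> to a closed path
      \<open>m\<close>. Its first half is \<open>k\<close>; since \<open>m\<close> is closed,
      running it backwards also starts at \<open>b\<close> and gives \<open>k'\<close>. Both end at
      the midpoint of \<open>m\<close>, so \<open>w = w'\<close>.\<close>
    define l where "l = r +++ reversepath r'"
    have "pathfinish r = pathstart (reversepath r')"
      using r r' by (simp add: pathstart_def pathfinish_def reversepath_def)
    then have l: "path l" "path_image l \<subseteq> E"
      using r r' path_image_join_subset[of r "reversepath r'"] unfolding l_def by auto
    have l01: "l 0 = a" "l 1 = a"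
      using r r' by (auto simp: l_def joinpaths_def reversepath_def)
    have lval: "l t = (if t \<le> 1/2 then r (2 * t) else r' (2 - 2 * t))" for t
      by (auto simp: l_def joinpaths_def reversepath_def algebra_simps)
    obtain m where m: "path m" "path_image m \<subseteq> E" "m 0 = b" "\<And>t. t \<in> {0..1} \<Longrightarrow> p (m t) = p (l t)"
      using lift[OF l l01(1)] by blast
    have "m 0 = m 1"
      by (rule simply_connected_loop_lift_closed[OF cov sc l(1,2) _ m(1,2,4)]) (use l01 in auto)
    have mc: "continuous_on {0..1} m" using m(1) by (simp add: path_def)
    have "m (1 / 2 * 1) = k 1"
    proof (rule covering_lift_unique[OF cov, of "{0..1::real}" 0 "\<lambda>t. m (1 / 2 * t)" k 1])
      show "continuous_on {0..1} (\<lambda>t. m (1 / 2 * t))"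
        by (rule continuous_on_compose2[OF mc]) (auto intro!: continuous_intros)
      show "p (m (1 / 2 * t)) = p (k t)" if "t \<in> {0..1}" for t
        using m(4)[of "1 / 2 * t"] k(5)[OF that] that by (auto simp: lval)
    qed (use k m in_image[OF m(2)] in_image[OF k(2)] in \<open>auto simp: path_def\<close>)
    moreover have "m (1 - 1 / 2 * 1) = k' 1"
    proof (rule covering_lift_unique[OF cov, of "{0..1::real}" 0 "\<lambda>t. m (1 - 1 / 2 * t)" k' 1])
      show "continuous_on {0..1} (\<lambda>t. m (1 - 1 / 2 * t))"
        by (rule continuous_on_compose2[OF mc]) (auto intro!: continuous_intros)
      show "p (m (1 - 1 / 2 * t)) = p (k' t)" if "t \<in> {0..1}" for t
        using m(4)[of "1 - 1 / 2 * t"] k'(5)[OF that] that r(4) r'(4) by (auto simp: lval)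
    qed (use k' m \<open>m 0 = m 1\<close> in_image[OF m(2)] in_image[OF k'(2)] in \<open>auto simp: path_def\<close>)
    ultimately show ?thesis using k(4) k'(4) by simp
  qed
  define \<gamma> where "\<gamma> y = (THE w. R y w)" for y
  have \<gamma>: "R y (\<gamma> y)" if "y \<in> E" for y
    unfolding \<gamma>_def using ex[OF that] unique by (intro theI'[of "R y"]) (auto intro: ex1I)
  have \<gamma>_eq: "\<gamma> y = w" if "R y w" for y w
    unfolding \<gamma>_def by (rule the_equality[of "R y", OF that]) (rule unique[OF _ that])
  have \<gamma>_im: "\<gamma> y \<in> E" and \<gamma>_p: "p (\<gamma> y) = p y" if y: "y \<in> E" for y
  proof -
    obtain r k where "path_image k \<subseteq> E" "r 1 = y" "k 1 = \<gamma> y"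
      "\<And>t. t \<in> {0..1} \<Longrightarrow> p (k t) = p (r t)"
      using \<gamma>[OF y] unfolding R_def by blast
    then show "\<gamma> y \<in> E" "p (\<gamma> y) = p y"
      using in_image[of k 1] by (metis atLeastAtMost_iff order_refl zero_le_one)+
  qed

  \<comment> \<open>Continuity: with \<open>q\<close> the section of \<open>p\<close> through the
    sheet of \<gamma> \<open>y\<close>, the map \<gamma> coincides with \<open>q\<close> after
    \<open>p\<close> near \<open>y\<close>. To see this, the two witnessing paths to
    \<open>y\<close> are prolonged by a short path \<open>s\<close> and by its image under
    \<open>q\<close> after \<open>p\<close>.\<close>
  have "openin (top_of_set E) (E \<inter> \<gamma> -` W)" if W: "openin (top_of_set E) W" for W
  proof (subst openin_subopen, intro ballI)
    fix y assume y: "y \<in> E \<inter> \<gamma> -` W"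
    obtain u T q where u: "\<gamma> y \<in> u" "openin (top_of_set E) u" "openin (top_of_set B) T"
      "homeomorphism u T p q"
      using covering_space_local_homeomorphism[OF cov \<gamma>_im[of y]] y by (metis IntD1)
    have uE: "u \<subseteq> E" using u(2) openin_imp_subset by blast
    have qT: "q \<in> T \<rightarrow> u" "continuous_on T q" "p (\<gamma> y) \<in> T"
      using u(1) homeomorphism_image2[OF u(4)] homeomorphism_image1[OF u(4)] homeomorphism_cont2[OF u(4)] by blast+
    have "openin (top_of_set T) (T \<inter> q -` (u \<inter> W))"
      using W uE by (intro continuous_openin_preimage[OF qT(2,1)])
        (metis inf.absorb_iff2 openin_subtopology_Int2 subtopology_subtopology)
    then have oT: "openin (top_of_set B) (T \<inter> q -` (u \<inter> W))"
      using u(3) openin_trans by blast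
    have "openin (top_of_set E) (E \<inter> p -` (T \<inter> q -` (u \<inter> W)))"
      by (rule continuous_openin_preimage[OF p(1) _ oT]) (use p in auto)
    moreover have "y \<in> E \<inter> p -` (T \<inter> q -` (u \<inter> W))"
      using y u(1) qT(3) \<gamma>_p[of y] homeomorphism_apply1[OF u(4,1)] by auto
    ultimately obtain V0 V where V: "openin (top_of_set E) V0" "path_connected V" "y \<in> V0" "V0 \<subseteq> V"
      "V \<subseteq> E \<inter> p -` (T \<inter> q -` (u \<inter> W))"
      by (rule locallyE[OF lpc])
    have "\<gamma> y' \<in> W" if y': "y' \<in> V" for y'
    proof -
      obtain s where s: "path s" "path_image s \<subseteq> V" "s 0 = y" "s 1 = y'"
        using V(2,3,4) y' unfolding path_connected_def pathstart_def pathfinish_def by blast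
      obtain r k where r: "path r" "path_image r \<subseteq> E" "r 0 = a" "r 1 = y" and
        k: "path k" "path_image k \<subseteq> E" "k 0 = b" "k 1 = \<gamma> y" "\<And>t. t \<in> {0..1} \<Longrightarrow> p (k t) = p (r t)"
        using \<gamma>[of y] y unfolding R_def by blast
      have sV: "s t \<in> V" if "t \<in> {0..1}" for t
        using s(2) that by (auto simp: path_image_def)
      have sc: "continuous_on {0..1} s" using s(1) by (simp add: path_def)
      have sT: "p (s t) \<in> T" "q (p (s t)) \<in> E" if "t \<in> {0..1}" for t
        using sV[OF that] V(5) uE by blast+
      have "continuous_on {0..1} (\<lambda>t. p (s t))"
        by (rule continuous_on_compose2[OF p(1) sc]) (use sV V(5) in auto)
      then have "continuous_on {0..1} (\<lambda>t. q (p (s t)))"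
        by (rule continuous_on_compose2[OF qT(2)]) (use sT in auto)
      then have qs: "path (q \<circ> p \<circ> s)" by (simp add: path_def o_def)
      have q0: "q (p (s 0)) = \<gamma> y"
        using homeomorphism_apply1[OF u(4,1)] \<gamma>_p[of y] y s(3) by simp
      have pq: "p (q (p (s t))) = p (s t)" if "t \<in> {0..1}" for t
        using homeomorphism_apply2[OF u(4)] sT[OF that] by auto
      have "R y' (q (p y'))"
        unfolding R_def
      proof (rule exI[of _ "r +++ s"], rule exI[of _ "k +++ (q \<circ> p \<circ> s)"], intro conjI ballI)
        show "path (r +++ s)"
          using r s by (intro path_join_imp) (auto simp: pathstart_def pathfinish_def)
        have "pathfinish k = pathstart (q \<circ> p \<circ> s)"
          using k q0 by (simp add: pathstart_def pathfinish_def)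
        then show "path (k +++ (q \<circ> p \<circ> s))"
          using k(1) qs by (intro path_join_imp)
        show "path_image (r +++ s) \<subseteq> E"
          using path_image_join_subset[of r s] r(2) s(2) V(5) by blast
        have "path_image (q \<circ> p \<circ> s) \<subseteq> E"
          using sT by (auto simp: path_image_def)
        then show "path_image (k +++ (q \<circ> p \<circ> s)) \<subseteq> E"
          using path_image_join_subset[of k "q \<circ> p \<circ> s"] k(2) by blast
        show "p ((k +++ (q \<circ> p \<circ> s)) t) = p ((r +++ s) t)" if "t \<in> {0..1}" for t
          using that k(5)[of "2 * t"] pq[of "2 * t - 1"] by (auto simp: joinpaths_def)
      qed (use r s k in \<open>auto simp: joinpaths_def\<close>)
      then have "\<gamma> y' = q (p y')" by (rule \<gamma>_eq)
      then show ?thesis using V(5) y' by auto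
    qed
    then show "\<exists>T. openin (top_of_set E) T \<and> y \<in> T \<and> T \<subseteq> E \<inter> \<gamma> -` W"
      using V by (intro exI[of _ V0]) blast
  qed
  then have "continuous_on E \<gamma>"
    using continuous_on_open_gen[of \<gamma> E E] \<gamma>_im by blast
  moreover have "R a b"
    unfolding R_def
    by (rule exI[of _ "\<lambda>_. a"], rule exI[of _ "\<lambda>_. b"])
       (use a b ab in \<open>auto simp: path_def path_image_def\<close>)
  ultimately show thesis
    using that \<gamma>_im \<gamma>_p \<gamma>_eq by blast
qed

section \<open>Deck transformations of holomorphic coverings\<close>

lemma complex_chart_inj: "complex_chart M U \<phi> \<Longrightarrow> inj_on \<phi> U"
  unfolding complex_chart_def by (metis homeomorphism_apply1 inj_onI)

lemma complex_chart_open_image: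
  assumes "complex_chart M U \<phi>" "openin (top_of_set M) T" "T \<subseteq> U"
  shows "open (\<phi> ` T)"
proof -
  obtain k where k: "homeomorphism U (\<phi> ` U) \<phi> k"
    using assms(1) by (auto simp: complex_chart_def)
  have U: "U \<subseteq> M" "open (\<phi> ` U)"
    using assms(1) openin_imp_subset by (auto simp: complex_chart_def)
  have "openin (top_of_set U) T"
    using openin_subset_trans[OF assms(2,3) U(1)] .
  then show ?thesis
    using homeomorphism_imp_open_map[OF k] U(2) openin_open_eq by blast
qed

text \<open>Charts carry small discs back to path connected neighbourhoods. The continuity of deck
  maps rests on this.\<close>

lemma riemann_surface_locally_path_connected:
  assumes "riemann_surface M A"
  shows "locally path_connected M"
proof (rule locallyI)
  fix w x assume w: "openin (top_of_set M) w" "x \<in> w"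
  then have "x \<in> M" using openin_imp_subset by blast
  then have "x \<in> (\<Union>(U, \<phi>)\<in>A. U)"
    using assms by (simp add: riemann_surface_def)
  then obtain U \<phi> where U: "(U, \<phi>) \<in> A" "x \<in> U" by blast
  then have ch: "complex_chart M U \<phi>" using assms by (auto simp: riemann_surface_def)
  then obtain k where k: "homeomorphism U (\<phi> ` U) \<phi> k" and oU: "openin (top_of_set M) U"
    by (auto simp: complex_chart_def)
  have "open (\<phi> ` (U \<inter> w))"
    using oU w by (intro complex_chart_open_image[OF ch] openin_Int) auto
  moreover have "\<phi> x \<in> \<phi> ` (U \<inter> w)" using U(2) w(2) by blast
  ultimately obtain e where e: "e > 0" "ball (\<phi> x) e \<subseteq> \<phi> ` (U \<inter> w)"
    by (meson open_contains_ball)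
  have bU: "ball (\<phi> x) e \<subseteq> \<phi> ` U" using e(2) by blast
  then have "openin (top_of_set (\<phi> ` U)) (ball (\<phi> x) e)"
    by (simp add: open_subset)
  then have "openin (top_of_set U) (k ` ball (\<phi> x) e)"
    using homeomorphism_imp_open_map[OF homeomorphism_symD[OF k]] by blast
  then have "openin (top_of_set M) (k ` ball (\<phi> x) e)"
    using oU openin_trans by blast
  moreover have "path_connected (k ` ball (\<phi> x) e)"
    using homeomorphism_cont2[OF k] bU
    by (intro path_connected_continuous_image convex_imp_path_connected)
       (auto intro: continuous_on_subset)
  moreover have "x \<in> k ` ball (\<phi> x) e"
    using e(1) homeomorphism_apply1[OF k U(2)] by (metis centre_in_ball imageI)
  moreover have "k ` ball (\<phi> x) e \<subseteq> w"
    using e(2) homeomorphism_apply1[OF k] by fastforce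
  ultimately show "\<exists>U V. openin (top_of_set M) U \<and> path_connected V \<and> x \<in> U \<and> U \<subseteq> V \<and> V \<subseteq> w"
    by blast
qed

text \<open>From \<open>p (\<gamma> y) = p y\<close> it follows that, in coordinates, \<gamma> is
  \<open>p\<close> near \<open>y\<close> followed by a local inverse of \<open>p\<close> near
  \<gamma> \<open>y\<close>. Both are read through one and the same chart of the base.\<close>

lemma continuous_deck_map_holo:
  assumes E: "riemann_surface E A" and p: "holo_map E A B AB p" and cov: "covering_space E p B"
    and charts: "\<And>U \<phi>. (U, \<phi>) \<in> AB \<Longrightarrow> complex_chart B U \<phi>"
    and covers: "\<And>x. x \<in> B \<Longrightarrow> \<exists>U \<phi>. (U, \<phi>) \<in> AB \<and> x \<in> U"
    and \<gamma>: "continuous_on E \<gamma>" "\<gamma> \<in> E \<rightarrow> E" "\<And>y. y \<in> E \<Longrightarrow> p (\<gamma> y) = p y"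
  shows "holo_map E A E A \<gamma>"
proof -
  have pB: "p \<in> E \<rightarrow> B" "continuous_on E p"
    and p_holo: "\<And>U \<phi> V \<psi>. (U, \<phi>) \<in> A \<Longrightarrow> (V, \<psi>) \<in> AB \<Longrightarrow>
      (\<psi> \<circ> p \<circ> inv_into U \<phi>) holomorphic_on \<phi> ` (U \<inter> p -` V)"
    using p by (auto simp: holo_map_def)
  have "(\<psi> \<circ> \<gamma> \<circ> inv_into U \<phi>) holomorphic_on \<phi> ` (U \<inter> \<gamma> -` V)"
    if U: "(U, \<phi>) \<in> A" and V: "(V, \<psi>) \<in> A" for U \<phi> V \<psi>
  proof -
    have cU: "complex_chart E U \<phi>" and cV: "complex_chart E V \<psi>"
      using E U V by (auto simp: riemann_surface_def)
    have oU: "openin (top_of_set E) U" and oV: "openin (top_of_set E) V"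
      using cU cV by (auto simp: complex_chart_def)
    have UE: "U \<subseteq> E" using oU openin_imp_subset by blast
    have "(\<psi> \<circ> \<gamma> \<circ> inv_into U \<phi>) field_differentiable at (\<phi> y)" if y: "y \<in> U" "\<gamma> y \<in> V" for y
    proof -
      have yE: "y \<in> E" "\<gamma> y \<in> E" using y(1) UE \<gamma>(2) by auto
      obtain W \<kappa> where W: "(W, \<kappa>) \<in> AB" "p y \<in> W" using covers pB(1) yE(1) by blast
      have oW: "openin (top_of_set B) W" and injW: "inj_on \<kappa> W"
        using charts[OF W(1)] complex_chart_inj by (auto simp: complex_chart_def)
      obtain u T q where u: "\<gamma> y \<in> u" "openin (top_of_set E) u" "homeomorphism u T p q"
        using covering_space_local_homeomorphism[OF cov yE(2)] by metis
      \<comment> \<open>On \<open>R\<close> three things hold at once: the chart \<psi> is defined,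
        \<open>p\<close> is injective, and \<open>p\<close> lands in the chart domain
        \<open>W\<close>.\<close>
      define R where "R = V \<inter> u \<inter> (E \<inter> p -` W)"
      have oR: "openin (top_of_set E) R"
        unfolding R_def by (intro openin_Int oV u(2) continuous_openin_preimage[OF pB(2,1) oW])
      define Q where "Q = U \<inter> (E \<inter> \<gamma> -` R)"
      have oQ: "openin (top_of_set E) Q"
        unfolding Q_def by (intro openin_Int oU continuous_openin_preimage[OF \<gamma>(1,2) oR])
      have yQ: "y \<in> Q" using y yE u(1) W(2) \<gamma>(3)[OF yE(1)] by (auto simp: Q_def R_def)
      have opR: "open (\<psi> ` R)" by (rule complex_chart_open_image[OF cV oR]) (auto simp: R_def)
      have opQ: "open (\<phi> ` Q)" by (rule complex_chart_open_image[OF cU oQ]) (auto simp: Q_def)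
      have invU: "inv_into U \<phi> (\<phi> w) = w" if "w \<in> U" for w
        using complex_chart_inj[OF cU] that by simp
      have invV: "inv_into V \<psi> (\<psi> w) = w" if "w \<in> V" for w
        using complex_chart_inj[OF cV] that by simp
      define b where "b = \<kappa> \<circ> p \<circ> inv_into V \<psi>"
      have b_hol: "b holomorphic_on \<psi> ` R"
        unfolding b_def by (rule holomorphic_on_subset[OF p_holo[OF V W(1)]]) (auto simp: R_def)
      have b_val: "b (\<psi> w) = \<kappa> (p w)" if "w \<in> R" for w
        using that invV by (simp add: b_def R_def)
      have "inj_on b (\<psi> ` R)"
      proof (rule inj_onI, elim imageE)
        fix z z' w w' assume eq: "b z = b z'" "z = \<psi> w" "z' = \<psi> w'" "w \<in> R" "w' \<in> R"
        then have "p w = p w'" using b_val injW by (auto simp: R_def dest: inj_onD)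
        then have "w = w'" using eq(4,5) homeomorphism_apply1[OF u(3)] by (metis IntD1 IntD2 R_def)
        then show "z = z'" using eq by simp
      qed
      \<comment> \<open>An injective holomorphic function has a holomorphic inverse on its image, so
        no derivative of \<open>p\<close> has to be computed.\<close>
      then obtain g where g: "g holomorphic_on b ` \<psi> ` R" "\<And>z. z \<in> \<psi> ` R \<Longrightarrow> g (b z) = z"
        using holomorphic_has_inverse[OF b_hol opR] by metis
      define a where "a = \<kappa> \<circ> p \<circ> inv_into U \<phi>"
      have a_eq: "a (\<phi> w) = b (\<psi> (\<gamma> w))" "\<gamma> w \<in> R" if "w \<in> Q" for w
        using that invU b_val[of "\<gamma> w"] \<gamma>(3)[of w] by (auto simp: a_def Q_def)
      have "a holomorphic_on \<phi> ` Q"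
        unfolding a_def
        by (rule holomorphic_on_subset[OF p_holo[OF U W(1)]]) (use \<gamma>(3) in \<open>auto simp: Q_def R_def\<close>)
      then have "(g \<circ> a) holomorphic_on \<phi> ` Q"
        by (rule holomorphic_on_compose_gen[OF _ g(1)]) (use a_eq in auto)
      then have "(\<psi> \<circ> \<gamma> \<circ> inv_into U \<phi>) holomorphic_on \<phi> ` Q"
      proof (rule holomorphic_transform)
        fix z assume "z \<in> \<phi> ` Q"
        then obtain w where w: "w \<in> Q" "z = \<phi> w" by blast
        then show "(g \<circ> a) z = (\<psi> \<circ> \<gamma> \<circ> inv_into U \<phi>) z"
          using a_eq[OF w(1)] g(2)[of "\<psi> (\<gamma> w)"] invU[of w] by (simp add: Q_def)
      qed
      then show ?thesis
        using opQ yQ holomorphic_on_imp_differentiable_at by blast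
    qed
    then show ?thesis
      by (auto simp: holomorphic_on_def intro: field_differentiable_at_within)
  qed
  then show ?thesis using \<gamma> by (auto simp: holo_map_def)
qed

lemma simply_connected_connected:
  fixes E :: "'a::topological_space set"
  assumes "simply_connected E"
  shows "connected E"
  by (rule path_connected_imp_connected)
     (unfold path_connected_def pathstart_def pathfinish_def, metis simply_connected_path_between[OF assms])

text \<open>For a holomorphic covering whose base is covered by charts, deck transformations are just the
  continuous ones; this makes the group axioms immediate.\<close>

locale holomorphic_covering =
  fixes E :: "'a::t2_space set" and A :: "'a atlas" and B :: "'b::topological_space set" and AB and p
  assumes surface: "riemann_surface E A" and p_holo: "holo_map E A B AB p"
    and cov: "covering_space E p B"
    and charts: "\<And>U \<phi>. (U, \<phi>) \<in> AB \<Longrightarrow> complex_chart B U \<phi>"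
    and covers: "\<And>x. x \<in> B \<Longrightarrow> \<exists>U \<phi>. (U, \<phi>) \<in> AB \<and> x \<in> U"
begin

lemma deck_carrier_iff:
  "\<gamma> \<in> carrier (deck_group E A p) \<longleftrightarrow>
     \<gamma> \<in> Bij E \<and> continuous_on E \<gamma> \<and> continuous_on E (inv_into E \<gamma>) \<and> (\<forall>y\<in>E. p (\<gamma> y) = p y)"
proof -
  have "holo_map E A E A \<gamma> \<and> holo_map E A E A (inv_into E \<gamma>)"
    if \<gamma>: "\<gamma> \<in> Bij E" "continuous_on E \<gamma>" "continuous_on E (inv_into E \<gamma>)" "\<forall>y\<in>E. p (\<gamma> y) = p y"
  proof
    have bij: "bij_betw \<gamma> E E" using \<gamma>(1) by (simp add: Bij_def)
    have "inv_into E \<gamma> y \<in> E" "\<gamma> (inv_into E \<gamma> y) = y" if "y \<in> E" for y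
      using bij that by (metis bij_betw_imp_surj_on inv_into_into, metis bij_betw_inv_into_right)
    then show "holo_map E A E A (inv_into E \<gamma>)"
      using \<gamma>(3,4) by (intro continuous_deck_map_holo[OF surface p_holo cov charts covers]) (auto, metis)
    show "holo_map E A E A \<gamma>"
      using \<gamma>(2,4) bij bij_betwE[OF bij]
      by (intro continuous_deck_map_holo[OF surface p_holo cov charts covers]) auto
  qed
  moreover have "continuous_on E g" if "holo_map E A E A g" for g
    using that by (simp add: holo_map_def)
  ultimately show ?thesis unfolding deck_group_def by auto
qed

lemma group_deck_group: "group (deck_group E A p)"
proof -
  let ?D = "carrier (deck_group E A p)"
  have BG: "group (BijGroup E)" by (rule group_BijGroup)
  have "subgroup ?D (BijGroup E)"
  proof
    show "?D \<subseteq> carrier (BijGroup E)"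
      by (auto simp: deck_carrier_iff BijGroup_def)
    have "inv_into E (\<lambda>x\<in>E. x) y = y" if "y \<in> E" for y
      using that by (metis inv_into_f_f inj_on_restrict_eq inj_on_id2 restrict_apply')
    then have "continuous_on E (inv_into E (\<lambda>x\<in>E. x))"
      using continuous_on_cong[of E E "inv_into E (\<lambda>x\<in>E. x)" "\<lambda>x. x"] continuous_on_id by blast
    then show "\<one>\<^bsub>BijGroup E\<^esub> \<in> ?D"
      by (simp add: deck_carrier_iff BijGroup_def id_Bij)
    fix f assume f: "f \<in> ?D"
    then have fB: "f \<in> Bij E" "bij_betw f E E" "continuous_on E f" "continuous_on E (inv_into E f)"
      "\<And>y. y \<in> E \<Longrightarrow> p (f y) = p y" by (auto simp: deck_carrier_iff Bij_def)
    have f_inv: "inv_into E f y \<in> E" "f (inv_into E f y) = y" "inv_into E f (f y) = y" "f y \<in> E"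
      if "y \<in> E" for y
      using fB(2) that by (metis bij_betw_imp_surj_on inv_into_into, metis bij_betw_inv_into_right,
          metis bij_betw_inv_into_left, metis bij_betwE)
    \<comment> \<open>The inverse in \<open>BijGroup E\<close> is the restriction of
      \<open>inv_into E f\<close> to \<open>E\<close>; inverting it again returns \<open>f\<close>
      on \<open>E\<close> only, which is enough for continuity there.\<close>
    define r where "r = (\<lambda>x\<in>E. inv_into E f x)"
    have r: "r \<in> Bij E" using restrict_inv_into_Bij[OF fB(1)] by (simp add: r_def)
    have "inv_into E r y = f y" if "y \<in> E" for y
      using r f_inv that by (intro inv_into_f_eq) (auto simp: Bij_def bij_betw_def r_def)
    then have "continuous_on E (inv_into E r)" using fB(3) continuous_on_cong by (metis (full_types))
    moreover have "continuous_on E r" using fB(4) by (simp add: r_def)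
    moreover have "p (r y) = p y" if "y \<in> E" for y
      using fB(5)[OF f_inv(1)[OF that]] f_inv(2)[OF that] that by (simp add: r_def)
    ultimately show "inv\<^bsub>BijGroup E\<^esub> f \<in> ?D"
      using r by (simp add: inv_BijGroup[OF fB(1)] deck_carrier_iff flip: r_def)
    fix g assume g: "g \<in> ?D"
    then have gB: "g \<in> Bij E" "bij_betw g E E" "continuous_on E g" "continuous_on E (inv_into E g)"
      "\<And>y. y \<in> E \<Longrightarrow> p (g y) = p y" by (auto simp: deck_carrier_iff Bij_def)
    have g_inv: "inv_into E g y \<in> E" "g (inv_into E g y) = y" "inv_into E g (g y) = y" "g y \<in> E"
      if "y \<in> E" for y
      using gB(2) that by (metis bij_betw_imp_surj_on inv_into_into, metis bij_betw_inv_into_right,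
          metis bij_betw_inv_into_left, metis bij_betwE)
    define c where "c = compose E f g"
    have c: "c \<in> Bij E" using compose_Bij[OF fB(1) gB(1)] by (simp add: c_def)
    have c_app: "c y = f (g y)" if "y \<in> E" for y using that by (simp add: c_def compose_eq)
    have "continuous_on E (\<lambda>y. f (g y))"
      by (rule continuous_on_compose2[OF fB(3) gB(3)]) (use g_inv in auto)
    then have "continuous_on E c" using c_app continuous_on_cong by (metis (full_types))
    moreover have "inv_into E c y = inv_into E g (inv_into E f y)" if "y \<in> E" for y
      using c f_inv g_inv that by (intro inv_into_f_eq) (auto simp: Bij_def bij_betw_def c_app)
    moreover have "continuous_on E (\<lambda>y. inv_into E g (inv_into E f y))"
      by (rule continuous_on_compose2[OF gB(4) fB(4)]) (use f_inv in auto)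
    ultimately have "continuous_on E c" "continuous_on E (inv_into E c)"
      using continuous_on_cong by (blast, metis (full_types))
    then have "c \<in> ?D"
      using c fB(5) gB(5) g_inv c_app by (simp add: deck_carrier_iff)
    then show "f \<otimes>\<^bsub>BijGroup E\<^esub> g \<in> ?D"
      using fB(1) gB(1) by (simp add: BijGroup_def c_def)
  qed
  then have "group (BijGroup E \<lparr>carrier := ?D\<rparr>)"
    using BG by (rule subgroup.subgroup_is_group)
  then show ?thesis by (simp add: deck_group_def)
qed

lemma deck_mult_apply:
  assumes "f \<in> carrier (deck_group E A p)" "g \<in> carrier (deck_group E A p)" "x \<in> E"
  shows "(f \<otimes>\<^bsub>deck_group E A p\<^esub> g) x = f (g x)"
  using assms by (simp add: deck_carrier_iff) (simp add: deck_group_def BijGroup_def compose_eq)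

lemma deck_one_apply: "x \<in> E \<Longrightarrow> \<one>\<^bsub>deck_group E A p\<^esub> x = x"
  by (simp add: deck_group_def BijGroup_def)

text \<open>One deck map takes \<open>a\<close> to \<open>b\<close>, another takes \<open>b\<close>
  to \<open>a\<close>. Each composite covers the identity and fixes a point, so by uniqueness of
  lifts it is the identity, and the maps are bijections.\<close>

lemma deck_transitive:
  assumes sc: "simply_connected E" and ab: "a \<in> E" "b \<in> E" "p a = p b"
  obtains \<gamma> where "\<gamma> \<in> carrier (deck_group E A p)" "\<gamma> a = b"
proof -
  have lpc: "locally path_connected E" by (rule riemann_surface_locally_path_connected[OF surface])
  obtain g where g: "continuous_on E g" "g \<in> E \<rightarrow> E" "\<And>y. y \<in> E \<Longrightarrow> p (g y) = p y" "g a = b"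
    by (rule covering_deck_map_exists[OF cov sc lpc ab], rule that)
  obtain h where h: "continuous_on E h" "h \<in> E \<rightarrow> E" "\<And>y. y \<in> E \<Longrightarrow> p (h y) = p y" "h b = a"
    by (rule covering_deck_map_exists[OF cov sc lpc ab(2,1) ab(3)[symmetric]], rule that)
  have inverse: "k (l y) = y"
    if "continuous_on E k" "k \<in> E \<rightarrow> E" "\<And>y. y \<in> E \<Longrightarrow> p (k y) = p y"
      "continuous_on E l" "l \<in> E \<rightarrow> E" "\<And>y. y \<in> E \<Longrightarrow> p (l y) = p y"
      "c \<in> E" "k (l c) = c" "y \<in> E" for k l c y
  proof (rule covering_lift_unique[OF cov simply_connected_connected[OF sc], of c "\<lambda>y. k (l y)" "\<lambda>y. y"])
    show "continuous_on E (\<lambda>y. k (l y))"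
      by (rule continuous_on_compose2[OF that(1,4)]) (use that(5) in auto)
    show "p (k (l y)) = p y" if "y \<in> E" for y
      using \<open>y \<in> E\<close> \<open>l \<in> E \<rightarrow> E\<close> \<open>\<And>y. y \<in> E \<Longrightarrow> p (k y) = p y\<close> \<open>\<And>y. y \<in> E \<Longrightarrow> p (l y) = p y\<close>
      by (metis PiE)
  qed (use that in auto)
  have gh: "g (h y) = y" "h (g y) = y" if "y \<in> E" for y
    using inverse[OF g(1-3) h(1-3) ab(2) _ that] inverse[OF h(1-3) g(1-3) ab(1) _ that] g(4) h(4) by auto
  \<comment> \<open>Elements of \<open>Bij E\<close> are extensional, hence the restriction.\<close>
  define \<gamma> where "\<gamma> = restrict g E"
  have "bij_betw g E E"
    by (rule bij_betw_byWitness[where f' = h]) (use gh g(2) h(2) in auto)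
  then have \<gamma>: "\<gamma> \<in> Bij E" by (simp add: \<gamma>_def Bij_def)
  have "inv_into E \<gamma> y = h y" if "y \<in> E" for y
    using \<gamma> gh h(2) that by (intro inv_into_f_eq) (auto simp: Bij_def bij_betw_def \<gamma>_def)
  then have "continuous_on E (inv_into E \<gamma>)" using h(1) continuous_on_cong by (metis (full_types))
  moreover have "continuous_on E \<gamma>" using g(1) by (simp add: \<gamma>_def)
  ultimately have "\<gamma> \<in> carrier (deck_group E A p)"
    using \<gamma> g(3) by (simp add: deck_carrier_iff \<gamma>_def)
  then show thesis using that g(4) ab(1) by (simp add: \<gamma>_def)
qed

end

section \<open>Charts of a smooth affine curve\<close>

text \<open>The partial derivatives are again polynomials. This gives the continuous dependence of
  the derivative on the point that the inverse function theorem asks for.\<close>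

lemma polynomial_fun_has_derivative:
  fixes f :: "complex ^ 'n \<Rightarrow> complex"
  assumes "f \<in> polynomial_funs"
  obtains D where "\<And>i. D i \<in> polynomial_funs"
    "\<And>y. (f has_derivative (\<lambda>v. \<Sum>i\<in>UNIV. D i y * v $ i)) (at y)"
proof -
  have "\<exists>D. (\<forall>i. D i \<in> polynomial_funs) \<and>
    (\<forall>y. (f has_derivative (\<lambda>v. \<Sum>i\<in>UNIV. D i y * v $ i)) (at y))"
    using assms
  proof induction
    case (const c)
    show ?case
      by (rule exI[of _ "\<lambda>_ _. 0"]) (auto intro: polynomial_funs.const)
  next
    case (coord k)
    have "(\<Sum>i\<in>UNIV. (if i = k then 1 else 0) * v $ i) = v $ k" for v :: "complex ^ 'n"
      by (simp add: if_distrib[of "\<lambda>a. a * _"] cong: if_cong)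
    then show ?case
      by (intro exI[of _ "\<lambda>i _. if i = k then 1 else 0"])
         (auto intro: polynomial_funs.const bounded_linear.has_derivative[OF bounded_linear_vec_nth] has_derivative_ident)
  next
    case (add f g)
    then obtain Df Dg where D: "\<And>i. Df i \<in> polynomial_funs" "\<And>i. Dg i \<in> polynomial_funs"
      "\<And>y. (f has_derivative (\<lambda>v. \<Sum>i\<in>UNIV. Df i y * v $ i)) (at y)"
      "\<And>y. (g has_derivative (\<lambda>v. \<Sum>i\<in>UNIV. Dg i y * v $ i)) (at y)"
      by blast
    show ?case
      by (rule exI[of _ "\<lambda>i y. Df i y + Dg i y"])
         (auto intro!: polynomial_funs.add D derivative_eq_intros simp: ring_distribs sum.distrib)
  next
    case (mult f g)
    then obtain Df Dg where D: "\<And>i. Df i \<in> polynomial_funs" "\<And>i. Dg i \<in> polynomial_funs"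
      "\<And>y. (f has_derivative (\<lambda>v. \<Sum>i\<in>UNIV. Df i y * v $ i)) (at y)"
      "\<And>y. (g has_derivative (\<lambda>v. \<Sum>i\<in>UNIV. Dg i y * v $ i)) (at y)"
      by blast
    have "((\<lambda>x. f x * g x) has_derivative
      (\<lambda>v. \<Sum>i\<in>UNIV. (f y * Dg i y + Df i y * g y) * v $ i)) (at y)" for y
    proof (rule has_derivative_eq_rhs[OF has_derivative_mult[OF D(3,4)]], rule ext)
      fix v
      have "(\<Sum>i\<in>UNIV. (f y * Dg i y + Df i y * g y) * v $ i) =
          (\<Sum>i\<in>UNIV. f y * (Dg i y * v $ i) + (Df i y * v $ i) * g y)"
        by (rule sum.cong) (auto simp: algebra_simps)
      then show "f y * (\<Sum>i\<in>UNIV. Dg i y * v $ i) + (\<Sum>i\<in>UNIV. Df i y * v $ i) * g y =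
          (\<Sum>i\<in>UNIV. (f y * Dg i y + Df i y * g y) * v $ i)"
        by (simp only: sum.distrib sum_distrib_left sum_distrib_right)
    qed
    moreover have "(\<lambda>y. f y * Dg i y + Df i y * g y) \<in> polynomial_funs" for i
      by (rule polynomial_funs.add[OF polynomial_funs.mult[OF mult.hyps(1) D(2)]
            polynomial_funs.mult[OF D(1) mult.hyps(2)]])
    ultimately show ?case
      by (intro exI[of _ "\<lambda>i y. f y * Dg i y + Df i y * g y"]) simp
  qed
  then show thesis using that by blast
qed

lemma polynomial_fun_continuous:
  assumes "f \<in> polynomial_funs"
  shows "continuous_on A f"
proof -
  obtain D where "\<And>y. (f has_derivative (\<lambda>v. \<Sum>i\<in>UNIV. D i y * v $ i)) (at y)"
    by (rule polynomial_fun_has_derivative[OF assms], rule that)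
  then have "isCont f y" for y by (rule has_derivative_continuous)
  then show ?thesis by (simp add: continuous_at_imp_continuous_on)
qed

text \<open>Translates the condition defining the tangent space, stated along complex lines, into
  vanishing of the gradient form on \<open>v\<close>.\<close>

lemma deriv_along_line:
  fixes f :: "complex ^ 'n \<Rightarrow> complex"
  assumes "(f has_derivative (\<lambda>v. \<Sum>i\<in>UNIV. d i * v $ i)) (at x)"
  shows "deriv (\<lambda>t. f (x + t *s v)) 0 = (\<Sum>i\<in>UNIV. d i * v $ i)"
proof -
  have "linear (\<lambda>t. t *s v)"
    by (rule linearI) (auto simp: vec_eq_iff ring_distribs)
  then have "((\<lambda>t. t *s v) has_derivative (\<lambda>t. t *s v)) (at 0)"
    by (intro bounded_linear.has_derivative[OF _ has_derivative_ident])
       (simp add: linear_conv_bounded_linear)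
  then have 1: "((\<lambda>t. x + t *s v) has_derivative (\<lambda>t. t *s v)) (at 0)"
    by (auto intro!: derivative_eq_intros)
  have "(f has_derivative (\<lambda>v. \<Sum>i\<in>UNIV. d i * v $ i)) (at (x + 0 *s v))"
    using assms by (simp add: vec.scale_zero_left)
  from has_derivative_compose[OF 1 this]
  have "((\<lambda>t. f (x + t *s v)) has_derivative (\<lambda>t. \<Sum>i\<in>UNIV. d i * (t * v $ i))) (at 0)"
    by simp
  then have "((\<lambda>t. f (x + t *s v)) has_field_derivative (\<Sum>i\<in>UNIV. d i * v $ i)) (at 0)"
    unfolding has_field_derivative_def
  proof (rule has_derivative_eq_rhs, intro ext)
    fix t show "(\<Sum>i\<in>UNIV. d i * (t * v $ i)) = (\<Sum>i\<in>UNIV. d i * v $ i) * t"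
      unfolding sum_distrib_right by (rule sum.cong) auto
  qed
  then show ?thesis by (rule DERIV_imp_deriv)
qed

text \<open>A basis of the span of the gradients of the equations of \<open>C\<close> has at most \<open>n\<close> elements, so \<open>n\<close>
  equations cut out the tangent space.\<close>

lemma immersive_equations:
  fixes C :: "(complex ^ 'n) set"
  assumes dim: "vec.dim (zariski_tangent_space C x) = 1"
  obtains k :: 'n and g D where "\<And>i::'n. g i \<in> vanishing_ideal C" "\<And>i j::'n. D i j \<in> polynomial_funs"
    "\<And>i y. (g i has_derivative (\<lambda>v. \<Sum>j\<in>UNIV. D i j y * v $ j)) (at y)"
    "\<And>v. v $ k = 0 \<Longrightarrow> (\<And>i. (\<Sum>j\<in>UNIV. D i j x * v $ j) = 0) \<Longrightarrow> v = 0"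
proof -
  let ?T = "zariski_tangent_space C x"
  define grad where "grad f u \<longleftrightarrow> (f has_derivative (\<lambda>v. \<Sum>i\<in>UNIV. u $ i * v $ i)) (at x)"
    for f and u :: "complex ^ 'n"
  define G where "G = {u. \<exists>f\<in>vanishing_ideal C. grad f u}"
  obtain B where B: "B \<subseteq> G" "vec.independent B" "G \<subseteq> vec.span B" "card B = vec.dim G"
    by (rule vec.basis_exists[of G], rule that)
  have fin: "finite B" using B(2) vec.finiteI_independent by blast
  have "card B \<le> vec.dim (UNIV :: (complex ^ 'n) set)"
    using vec.independent_card_le_dim[OF _ B(2), of UNIV] by simp
  then have "card B \<le> CARD('n)" by (simp add: card_cart_basis)
  then obtain h :: "complex ^ 'n \<Rightarrow> 'n" where h: "inj_on h B"
    using card_le_inj[OF fin, of "UNIV :: 'n set"] by (metis finite)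
  have "\<exists>f\<in>vanishing_ideal C. i \<in> h ` B \<longrightarrow> grad f (inv_into B h i)" for i
  proof (cases "i \<in> h ` B")
    case True
    then have "inv_into B h i \<in> G" using B(1) inv_into_into by (metis subsetD)
    then show ?thesis by (auto simp: G_def)
  next
    case False
    have "(\<lambda>_. 0) \<in> vanishing_ideal C"
      by (auto simp: vanishing_ideal_def intro: polynomial_funs.const)
    then show ?thesis using False by blast
  qed
  then obtain g where g: "\<And>i. g i \<in> vanishing_ideal C" "\<And>i. i \<in> h ` B \<Longrightarrow> grad (g i) (inv_into B h i)"
    by metis
  have "\<exists>D. (\<forall>j. D j \<in> polynomial_funs) \<and>
    (\<forall>y. (g i has_derivative (\<lambda>v. \<Sum>j\<in>UNIV. D j y * v $ j)) (at y))" for i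
  proof -
    have "g i \<in> polynomial_funs" using g(1)[of i] by (simp add: vanishing_ideal_def)
    then show ?thesis by (rule polynomial_fun_has_derivative) blast
  qed
  then obtain D where D: "\<And>i j. D i j \<in> polynomial_funs"
    "\<And>i y. (g i has_derivative (\<lambda>v. \<Sum>j\<in>UNIV. D i j y * v $ j)) (at y)"
    by metis
  \<comment> \<open>A vector killed by the chosen gradients is killed by their span, which contains
    the gradient of every equation of \<open>C\<close> at \<open>x\<close>.\<close>
  have tangent: "v \<in> ?T" if v: "\<And>i. (\<Sum>j\<in>UNIV. D i j x * v $ j) = 0" for v
  proof -
    have "(\<Sum>j\<in>UNIV. b $ j * v $ j) = 0" if "b \<in> B" for b
    proof -
      have "grad (g (h b)) b" using g(2)[of "h b"] h that by simp
      then have "(\<lambda>v. \<Sum>j\<in>UNIV. b $ j * v $ j) = (\<lambda>v. \<Sum>j\<in>UNIV. D (h b) j x * v $ j)"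
        using D(2)[of "h b" x] unfolding grad_def by (rule has_derivative_unique)
      then show ?thesis using v[of "h b"] by metis
    qed
    then have "B \<subseteq> {u. (\<Sum>j\<in>UNIV. u $ j * v $ j) = 0}" by blast
    moreover have "vec.subspace {u. (\<Sum>j\<in>UNIV. u $ j * v $ j) = 0}"
      by (auto simp: vec.subspace_def ring_distribs sum.distrib mult.assoc simp flip: sum_distrib_left)
    ultimately have span: "vec.span B \<subseteq> {u. (\<Sum>j\<in>UNIV. u $ j * v $ j) = 0}"
      by (rule vec.span_minimal)
    show ?thesis
      unfolding zariski_tangent_space_def
    proof (intro CollectI ballI)
      fix f assume f: "f \<in> vanishing_ideal C"
      then have fp: "f \<in> polynomial_funs" by (simp add: vanishing_ideal_def)
      obtain d where d: "\<And>y. (f has_derivative (\<lambda>v. \<Sum>j\<in>UNIV. d j y * v $ j)) (at y)"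
        by (rule polynomial_fun_has_derivative[OF fp], rule that)
      have "grad f (\<chi> j. d j x)" using d[of x] by (simp add: grad_def)
      then have "(\<chi> j. d j x) \<in> vec.span B" using f B(3) by (auto simp: G_def)
      then have "(\<Sum>j\<in>UNIV. d j x * v $ j) = 0" using span by auto
      then show "deriv (\<lambda>t. f (x + t *s v)) 0 = 0"
        using deriv_along_line[OF d, of x v] by simp
    qed
  qed
  obtain V where V: "V \<subseteq> ?T" "vec.independent V" "?T \<subseteq> vec.span V" "card V = vec.dim ?T"
    by (rule vec.basis_exists[of ?T], rule that)
  have "card V = 1" using V(4) dim by simp
  then obtain v0 where v0: "V = {v0}" by (rule card_1_singletonE)
  then have "v0 \<noteq> 0" using V(2) by (auto simp: vec.dependent_single)
  \<comment> \<open>The tangent space is the line through \<open>v0\<close>. A coordinate that does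
    not vanish on \<open>v0\<close> is therefore injective on it, and is the future local
    parameter.\<close>
  then obtain k where k: "v0 $ k \<noteq> 0" by (auto simp: vec_eq_iff)
  show thesis
  proof (rule that[of g D k, OF g(1) D])
    fix v assume v: "v $ k = 0" "\<And>i. (\<Sum>j\<in>UNIV. D i j x * v $ j) = 0"
    have "v \<in> ?T" by (rule tangent, rule v(2))
    then obtain a where "v = a *s v0"
      using V(3) v0 by (auto simp: vec.span_singleton)
    then show "v = 0" using v(1) k by simp
  qed
qed

text \<open>Supplies the topological dimension of \<open>C\<close> at \<open>x\<close>, for use with
  invariance of domain. The conclusion covers all open subsets of \<open>N\<close>, because the
  neighbourhood is later shrunk to the domain of the inverse function theorem.\<close>

lemma compactification_local_chart:
  assumes comp: "smooth_compactification C A Cbar B j" and x: "x \<in> C"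
  obtains N where "openin (top_of_set C) N" "x \<in> N"
    "\<And>U. openin (top_of_set C) U \<Longrightarrow> U \<subseteq> N \<Longrightarrow> \<exists>(W::complex set) a b. open W \<and> homeomorphism U W a b"
proof -
  have rs: "riemann_surface Cbar B" and j: "continuous_on C j" "j \<in> C \<rightarrow> Cbar"
    and oj: "openin (top_of_set Cbar) (j ` C)"
    using comp by (auto simp: smooth_compactification_def holo_map_def)
  obtain k where k: "homeomorphism C (j ` C) j k"
    using comp by (auto simp: smooth_compactification_def)
  have "j x \<in> (\<Union>(U, \<phi>)\<in>B. U)" using rs j(2) x by (auto simp: riemann_surface_def)
  then obtain V \<psi> where V: "(V, \<psi>) \<in> B" "j x \<in> V" by blast
  then have cV: "openin (top_of_set Cbar) V" "open (\<psi> ` V)" "\<exists>l. homeomorphism V (\<psi> ` V) \<psi> l"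
    using rs by (auto simp: riemann_surface_def complex_chart_def)
  then obtain l where l: "homeomorphism V (\<psi> ` V) \<psi> l" by blast
  show thesis
  proof (rule that[of "C \<inter> j -` V"])
    show "openin (top_of_set C) (C \<inter> j -` V)"
      by (rule continuous_openin_preimage[OF j cV(1)])
    show "x \<in> C \<inter> j -` V" using x V by simp
    fix U assume U: "openin (top_of_set C) U" "U \<subseteq> C \<inter> j -` V"
    have "openin (top_of_set (j ` C)) (j ` U)"
      using homeomorphism_imp_open_map[OF k U(1)] .
    then have "openin (top_of_set Cbar) (j ` U)"
      using oj openin_trans by blast
    then have "openin (top_of_set V) (j ` U)"
      using U(2) openin_imp_subset[OF cV(1)] by (rule_tac openin_subset_trans) auto
    then have "openin (top_of_set (\<psi> ` V)) (\<psi> ` j ` U)"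
      using homeomorphism_imp_open_map[OF l] by blast
    then have "open (\<psi> ` j ` U)" using cV(2) openin_open_eq by blast
    moreover have "homeomorphism U (j ` U) j k"
      using homeomorphism_of_subsets[OF k] U(2) by auto
    moreover have "homeomorphism (j ` U) (\<psi> ` j ` U) \<psi> l"
      using homeomorphism_of_subsets[OF l, of "j ` U"] U(2) by auto
    ultimately show "\<exists>(W::complex set) a b. open W \<and> homeomorphism U W a b"
      using homeomorphism_compose by blast
  qed
qed

lemma has_derivative_vec_lambda:
  fixes f :: "'n::finite \<Rightarrow> 'a::real_normed_vector \<Rightarrow> 'b::euclidean_space"
  assumes "\<And>i. (f i has_derivative f' i) (at x within S)"
  shows "((\<lambda>y. \<chi> i. f i y) has_derivative (\<lambda>v. \<chi> i. f' i v)) (at x within S)"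
  unfolding has_derivative_componentwise_within[of "\<lambda>y. \<chi> i. f i y"]
proof
  fix e :: "'b ^ 'n" assume "e \<in> Basis"
  then obtain k u where e: "e = axis k u" by (auto simp: Basis_vec_def)
  show "((\<lambda>y. (\<chi> i. f i y) \<bullet> e) has_derivative (\<lambda>v. (\<chi> i. f' i v) \<bullet> e)) (at x within S)"
    using has_derivative_inner_left[OF assms[of k], of u] by (simp add: e inner_axis)
qed

text \<open>With a left inverse \<open>G\<close> of the derivative at \<open>x\<close> of the immersion \<open>F\<close> of
  \<open>immersive_equations\<close>, the map \<open>G \<circ> F\<close> is a local diffeomorphism. On \<open>C\<close> the immersion is
  the coordinate \<open>y $ k\<close>, so that the coordinate is injective near \<open>x\<close>. It has open image
  by invariance of domain, because the compactification makes \<open>C\<close> a topological surface.\<close>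

lemma affine_curve_atlas_covers:
  fixes C :: "(complex ^ 'n) set"
  assumes curve: "smooth_connected_affine_curve C" and x: "x \<in> C"
    and comp: "smooth_compactification C A Cbar B j"
  obtains U \<phi> where "(U, \<phi>) \<in> affine_curve_atlas C" "x \<in> U"
proof -
  have "vec.dim (zariski_tangent_space C x) = 1"
    using curve x by (simp add: smooth_connected_affine_curve_def)
  then obtain k :: 'n and g D where g: "\<And>i::'n. g i \<in> vanishing_ideal C"
    and D: "\<And>i j::'n. D i j \<in> polynomial_funs"
      "\<And>i y. (g i has_derivative (\<lambda>v. \<Sum>j\<in>UNIV. D i j y * v $ j)) (at y)"
    and inj: "\<And>v. v $ k = 0 \<Longrightarrow> (\<And>i. (\<Sum>j\<in>UNIV. D i j x * v $ j) = 0) \<Longrightarrow> v = 0"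
    by (rule immersive_equations) blast
  define F :: "complex ^ 'n \<Rightarrow> complex \<times> (complex ^ 'n)" where "F y = (y $ k, \<chi> i. g i y)" for y
  define F' :: "complex ^ 'n \<Rightarrow> complex ^ 'n \<Rightarrow> complex \<times> (complex ^ 'n)"
    where "F' y v = (v $ k, \<chi> i. \<Sum>j\<in>UNIV. D i j y * v $ j)" for y v
  have F: "(F has_derivative F' y) (at y)" for y
    unfolding F_def[abs_def] F'_def[abs_def]
    by (intro has_derivative_Pair bounded_linear.has_derivative[OF bounded_linear_vec_nth] has_derivative_ident
        has_derivative_vec_lambda D)
  have lin: "linear (F' y)" for y using F has_derivative_linear by blast
  have scale: "F' y (a *s v) = (a * fst (F' y v), a *s snd (F' y v))" for y a v
    by (simp add: F'_def vec_eq_iff sum_distrib_left mult_ac)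
  have "inj (F' x)"
    unfolding linear_injective_0[OF lin]
  proof (intro allI impI)
    fix v assume "F' x v = 0"
    then have "v $ k = 0" "\<And>i. (\<Sum>j\<in>UNIV. D i j x * v $ j) = 0"
      by (simp_all add: F'_def zero_prod_def vec_eq_iff)
    then show "v = 0" by (rule inj)
  qed
  \<comment> \<open>\<open>G\<close> is only known to be real linear, so \<open>H\<close> and its
    inverse \<open>K\<close> are treated as real differentiable maps. Complex linearity of
    derivatives is recovered later from \<open>F\<close>.\<close>
  then obtain G where G: "linear G" "G \<circ> F' x = id"
    using linear_injective_left_inverse[OF lin] by blast
  then have blG: "bounded_linear G" by (simp add: linear_conv_bounded_linear)
  have bl: "bounded_linear (\<lambda>v. G (F' y v))" for y
    using bounded_linear_compose[OF blG has_derivative_bounded_linear[OF F]] .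
  define H where "H y = G (F y)" for y
  define H' where "H' y = Blinfun (\<lambda>v. G (F' y v))" for y
  have H'_apply: "blinfun_apply (H' y) = (\<lambda>v. G (F' y v))" for y
    by (simp add: H'_def bounded_linear_Blinfun_apply bl)
  have H: "(H has_derivative blinfun_apply (H' y)) (at y)" for y
    unfolding H_def[abs_def] H'_apply by (rule bounded_linear.has_derivative[OF blG F])
  have contG: "continuous_on UNIV G" using blG linear_continuous_on by blast
  have "continuous_on UNIV (\<lambda>y. F' y v)" for v
    unfolding F'_def by (intro continuous_intros continuous_on_vec_lambda polynomial_fun_continuous D)
  then have "continuous_on UNIV (\<lambda>y. blinfun_apply (H' y) v)" for v
    unfolding H'_apply by (intro continuous_on_compose2[OF contG]) auto
  then have contH: "continuous_on UNIV H'" by (rule continuous_on_blinfun_componentwise)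
  have inv_eq: "id_blinfun o\<^sub>L H' x = id_blinfun"
    using G(2) by (intro blinfun_eqI) (simp add: H'_apply fun_eq_iff)
  obtain U' V K K' where U': "open U'" "U' \<subseteq> UNIV" "x \<in> U'" "open V" "H x \<in> V" "homeomorphism U' V H K"
    and K: "\<And>y. y \<in> V \<Longrightarrow> (K has_derivative K' y) (at y)"
      "\<And>y. y \<in> V \<Longrightarrow> K' y = inv_into UNIV (blinfun_apply (H' (K y)))"
      "\<And>y. y \<in> V \<Longrightarrow> bij (blinfun_apply (H' (K y)))"
    by (rule inverse_function_theorem[OF open_UNIV H contH UNIV_I inv_eq], rule that)
  obtain N where N: "openin (top_of_set C) N" "x \<in> N"
    "\<And>U. openin (top_of_set C) U \<Longrightarrow> U \<subseteq> N \<Longrightarrow> \<exists>(W::complex set) a b. open W \<and> homeomorphism U W a b"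
    by (rule compactification_local_chart[OF comp x], rule that)
  define U where "U = N \<inter> U'"
  have U: "openin (top_of_set C) U" "x \<in> U" "U \<subseteq> N" "U \<subseteq> C" "U \<subseteq> U'"
    using N U' openin_imp_subset[OF N(1)] by (auto simp: U_def intro: openin_Int_open)
  obtain W :: "complex set" and a b where W: "open W" "homeomorphism U W a b"
    using N(3)[OF U(1,3)] by blast
  define t where "t y = y $ k" for y :: "complex ^ 'n"
  \<comment> \<open>The equations vanish on \<open>C\<close>, so there
    \<open>F y = (y $ k, 0)\<close>; hence \<open>c\<close> recovers a point of \<open>U\<close>
    from its coordinate.\<close>
  define c where "c w = K (G (w, 0))" for w
  have FU: "F y = (t y, 0)" if "y \<in> U" for y
    using that U(4) g by (auto simp: F_def t_def vanishing_ideal_def vec_eq_iff)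
  have HV: "G (t y, 0) \<in> V" and ct: "c (t y) = y" if "y \<in> U" for y
  proof -
    have "H y \<in> V" "K (H y) = y"
      using homeomorphism_image1[OF U'(6)] homeomorphism_apply1[OF U'(6), of y] U(5) that by blast+
    then show "G (t y, 0) \<in> V" "c (t y) = y"
      using FU[OF that] by (auto simp: c_def H_def)
  qed
  have tcont: "continuous_on U t" unfolding t_def by (intro continuous_intros)
  have "open ((t \<circ> b) ` W)"
  proof (rule invariance_of_domain[OF _ W(1)])
    show "continuous_on W (t \<circ> b)"
      using homeomorphism_cont2[OF W(2)] homeomorphism_image2[OF W(2)] tcont
      by (intro continuous_on_compose) auto
    show "inj_on (t \<circ> b) W"
    proof (rule inj_onI)
      fix v w assume vw: "v \<in> W" "w \<in> W" "(t \<circ> b) v = (t \<circ> b) w"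
      then have "b v \<in> U" "b w \<in> U" using homeomorphism_image2[OF W(2)] by blast+
      then have "b v = b w" using ct vw(3) by (metis comp_apply)
      then show "v = w" using homeomorphism_apply2[OF W(2)] vw(1,2) by metis
    qed
  qed
  then have open_t: "open (t ` U)"
    by (simp only: image_comp[symmetric] homeomorphism_image2[OF W(2)])
  have c: "(c has_derivative (\<lambda>d. K' (G (t y, 0)) (G (d, 0)))) (at (t y))" if "y \<in> U" for y
  proof -
    have "((\<lambda>w. G (w, 0)) has_derivative (\<lambda>d. G (d, 0))) (at (t y))"
      by (intro bounded_linear.has_derivative[OF blG]) (auto intro!: derivative_eq_intros)
    from has_derivative_compose[OF this K(1)[OF HV[OF that]]] show ?thesis by (simp add: c_def[abs_def])
  qed
  have holo: "\<exists>e. \<forall>i. ((\<lambda>w. c w $ i) has_field_derivative e $ i) (at (t y))" if y: "y \<in> U" for y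
  proof -
    define c' where "c' d = K' (G (t y, 0)) (G (d, 0))" for d
    have cy: "(c has_derivative c') (at (t y))" using c[OF y] by (simp add: c'_def[abs_def])
    have "((\<lambda>w. F (c w)) has_derivative (\<lambda>d. F' y (c' d))) (at (t y))"
      using has_derivative_compose[OF cy F] ct[OF y] by simp
    moreover have "((\<lambda>w. F (c w)) has_derivative (\<lambda>d. (d, 0))) (at (t y))"
    proof (rule has_derivative_transform_within_open[OF _ open_t])
      show "((\<lambda>w. (w, 0)) has_derivative (\<lambda>d. (d, 0))) (at (t y))"
        by (auto intro!: derivative_eq_intros)
      show "(w, 0) = F (c w)" if "w \<in> t ` U" for w
        using that ct FU by auto
    qed (use y in auto)
    ultimately have "(\<lambda>d. F' y (c' d)) = (\<lambda>d. (d, 0))" by (rule has_derivative_unique)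
    then have Fc: "F' y (c' d) = (d, 0)" for d by (rule fun_cong)
    have "K (G (t y, 0)) = y" using ct[OF y] by (simp add: c_def)
    then have "inj (\<lambda>v. G (F' y v))"
      using K(3)[OF HV[OF y]] bij_is_inj by (simp add: H'_apply)
    then have injF: "F' y u = F' y v \<Longrightarrow> u = v" for u v by (metis injD)
    have lin_c: "c' d = d *s c' 1" for d
      by (rule injF) (simp add: scale Fc)
    have "((\<lambda>w. c w $ i) has_field_derivative c' 1 $ i) (at (t y))" for i
    proof -
      have "((\<lambda>w. c w $ i) has_derivative (\<lambda>d. c' d $ i)) (at (t y))"
        by (rule bounded_linear.has_derivative[OF bounded_linear_vec_nth cy])
      then show ?thesis
        unfolding has_field_derivative_def
      proof (rule has_derivative_eq_rhs, intro ext)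
        fix d show "c' d $ i = c' 1 $ i * d"
          using arg_cong[OF lin_c[of d], of "\<lambda>v. v $ i"] by (simp add: mult.commute)
      qed
    qed
    then show ?thesis by blast
  qed
  have ccont: "continuous_on (t ` U) c"
  proof (rule continuous_at_imp_continuous_on, rule ballI)
    fix w assume "w \<in> t ` U"
    then obtain y where "y \<in> U" "w = t y" by blast
    then show "isCont c w" using has_derivative_continuous[OF c] by simp
  qed
  have hom: "homeomorphism U (t ` U) t c"
    using tcont ccont ct by (auto simp: homeomorphism_def image_image)
  have "inj_on t U" using ct by (metis inj_onI)
  then have inv: "inv_into U t w = c w" if "w \<in> t ` U" for w
    using that ct by (auto simp: inv_into_f_f)
  have "(U, t) \<in> affine_curve_atlas C"
    unfolding affine_curve_atlas_def
  proof (intro CollectI case_prodI conjI allI ballI)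
    show "complex_chart C U t"
      using U(1) open_t hom by (auto simp: complex_chart_def)
    show "(\<lambda>z. inv_into U t z $ i) holomorphic_on t ` U" for i
    proof (rule holomorphic_transform[of "\<lambda>z. c z $ i"])
      have "(\<lambda>z. c z $ i) field_differentiable at w" if "w \<in> t ` U" for w
        using that holo unfolding field_differentiable_def by blast
      then show "(\<lambda>z. c z $ i) holomorphic_on t ` U"
        by (auto simp: holomorphic_on_def intro: field_differentiable_at_within)
    qed (simp add: inv)
    show "\<exists>i. deriv (\<lambda>w. inv_into U t w $ i) z \<noteq> 0" if z: "z \<in> t ` U" for z
    proof (rule exI[of _ k])
      \<comment> \<open>The inverse chart followed by the coordinate \<open>k\<close> is the
        identity near \<open>z\<close>, so that component has derivative 1 and the parametrization
        is regular.\<close>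
      have "deriv (\<lambda>w. inv_into U t w $ k) z = deriv (\<lambda>w. w) z"
      proof (rule deriv_cong_ev[OF _ refl])
        have "inv_into U t w $ k = w" if "w \<in> t ` U" for w
          using that ct by (auto simp: inv t_def)
        then show "\<forall>\<^sub>F w in nhds z. inv_into U t w $ k = w"
          using open_t z by (metis (mono_tags, lifting) eventually_nhds)
      qed
      then show "deriv (\<lambda>w. inv_into U t w $ k) z \<noteq> 0" by simp
    qed
  qed
  then show thesis using that U(2) by blast
qed

section \<open>Moderate functions with nilpotent differences\<close>

lemma upper_half_plane_add_1_iff [simp]: "u + 1 \<in> upper_half_plane \<longleftrightarrow> u \<in> upper_half_plane"
  by (simp add: upper_half_plane_def)

section \<open>Moderate functions form an algebra\<close>

lemma moderate_half_plane_funs_iff: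
  "f \<in> moderate_half_plane_funs \<longleftrightarrow> f \<in> extensional upper_half_plane \<and> f holomorphic_on upper_half_plane \<and>
     (\<exists>n>0. \<exists>K :: real \<Rightarrow> real \<Rightarrow> real. \<forall>a b. a \<le> b \<longrightarrow> K a b \<ge> 0 \<and>
        (\<forall>u\<in>upper_half_plane. Re u \<in> {a..b} \<longrightarrow> cmod (f u) \<le> K a b * exp (2 * pi * real n * Im u)))"
proof -
  have "(\<forall>x\<in>{a..b}. \<forall>y>0. P (Complex x y)) \<longleftrightarrow> (\<forall>u\<in>upper_half_plane. Re u \<in> {a..b} \<longrightarrow> P u)"
    for P and a b :: real
  proof (intro iffI ballI impI allI)
    fix u assume "\<forall>x\<in>{a..b}. \<forall>y>0. P (Complex x y)" "u \<in> upper_half_plane" "Re u \<in> {a..b}"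
    then have "P (Complex (Re u) (Im u))" unfolding upper_half_plane_def by blast
    then show "P u" by simp
  qed (simp add: upper_half_plane_def)
  from this[of _ _ "\<lambda>u. cmod (f u) \<le> _ * exp (2 * pi * real _ * Im u)"] show ?thesis
    by (simp add: moderate_half_plane_funs_def hol_funs_plane)
qed

lemma moderate_half_plane_funsI:
  assumes "f \<in> extensional upper_half_plane" "f holomorphic_on upper_half_plane" "n > 0"
    "\<And>a b. a \<le> b \<Longrightarrow> K a b \<ge> 0"
    "\<And>a b u. a \<le> b \<Longrightarrow> u \<in> upper_half_plane \<Longrightarrow> a \<le> Re u \<Longrightarrow> Re u \<le> b \<Longrightarrow>
       cmod (f u) \<le> K a b * exp (2 * pi * real n * Im u)"
  shows "f \<in> moderate_half_plane_funs"
  unfolding moderate_half_plane_funs_iff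
  using assms by (intro conjI exI[of _ n] exI[of _ K]) auto

lemma moderate_half_plane_funsE:
  assumes "f \<in> moderate_half_plane_funs"
  obtains n K where "f \<in> extensional upper_half_plane" "f holomorphic_on upper_half_plane" "n > 0"
    "\<And>a b. a \<le> b \<Longrightarrow> K a b \<ge> 0"
    "\<And>a b u. a \<le> b \<Longrightarrow> u \<in> upper_half_plane \<Longrightarrow> a \<le> Re u \<Longrightarrow> Re u \<le> b \<Longrightarrow>
       cmod (f u) \<le> K a b * exp (2 * pi * real n * Im u)"
proof -
  obtain n K where "n > 0" "\<forall>a b. a \<le> b \<longrightarrow> K a b \<ge> 0 \<and>
      (\<forall>u\<in>upper_half_plane. Re u \<in> {a..b} \<longrightarrow> cmod (f u) \<le> K a b * exp (2 * pi * real n * Im u))"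
    using assms unfolding moderate_half_plane_funs_iff by blast
  then show thesis
    using assms by (intro that[of n K]) (auto simp: moderate_half_plane_funs_iff)
qed

lemma moderate_const: "(\<lambda>u\<in>upper_half_plane. c) \<in> moderate_half_plane_funs"
proof (rule moderate_half_plane_funsI[where n = 1 and K = "\<lambda>_ _. cmod c"])
  show "(\<lambda>u\<in>upper_half_plane. c) holomorphic_on upper_half_plane"
    by (rule holomorphic_transform[of "\<lambda>_. c"]) auto
  show "cmod ((\<lambda>u\<in>upper_half_plane. c) u) \<le> cmod c * exp (2 * pi * real 1 * Im u)"
    if "u \<in> upper_half_plane" for u
  proof -
    have "1 \<le> exp (2 * pi * Im u)" using that by (simp add: upper_half_plane_def)
    then show ?thesis using that mult_left_mono[of 1 _ "cmod c"] by simp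
  qed
qed auto

lemma moderate_scaled_id: "(\<lambda>u\<in>upper_half_plane. c * u) \<in> moderate_half_plane_funs"
proof (rule moderate_half_plane_funsI[where n = 1 and K = "\<lambda>a b. cmod c * (\<bar>a\<bar> + \<bar>b\<bar> + 1)"])
  show "(\<lambda>u\<in>upper_half_plane. c * u) holomorphic_on upper_half_plane"
    by (rule holomorphic_transform[of "\<lambda>u. c * u"]) (auto intro!: holomorphic_intros)
  fix a b u assume u: "u \<in> upper_half_plane" "a \<le> Re u" "Re u \<le> b"
  then have y: "Im u > 0" by (simp add: upper_half_plane_def)
  \<comment> \<open>In \<open>K\<close>, the part |a| + |b| bounds |Re u|, and the summand 1 pays
    for Im u through 1 + Im u \<le> exp(2 pi Im u).\<close>
  have "1 + 1 * Im u \<le> 1 + (2 * pi) * Im u"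
    using y pi_ge_two by (intro add_left_mono mult_right_mono) auto
  also have "\<dots> \<le> exp (2 * pi * Im u)" by (rule exp_ge_add_one_self)
  finally have e: "1 + Im u \<le> exp (2 * pi * Im u)" by simp
  have "cmod u \<le> \<bar>Re u\<bar> + \<bar>Im u\<bar>" by (rule cmod_le)
  also have "\<dots> \<le> (\<bar>a\<bar> + \<bar>b\<bar>) * 1 + exp (2 * pi * Im u)" using u y e by auto
  also have "\<dots> \<le> (\<bar>a\<bar> + \<bar>b\<bar>) * exp (2 * pi * Im u) + exp (2 * pi * Im u)"
    using e y by (intro add_right_mono mult_left_mono) auto
  finally have "cmod u \<le> (\<bar>a\<bar> + \<bar>b\<bar> + 1) * exp (2 * pi * Im u)" by (simp add: algebra_simps)
  then have "cmod c * cmod u \<le> cmod c * ((\<bar>a\<bar> + \<bar>b\<bar> + 1) * exp (2 * pi * Im u))"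
    by (rule mult_left_mono) simp
  then show "cmod ((\<lambda>u\<in>upper_half_plane. c * u) u) \<le>
      cmod c * (\<bar>a\<bar> + \<bar>b\<bar> + 1) * exp (2 * pi * real 1 * Im u)"
    using u(1) by (simp add: norm_mult mult.assoc)
qed auto

lemma moderate_add:
  assumes "f \<in> moderate_half_plane_funs" "g \<in> moderate_half_plane_funs"
  shows "(\<lambda>u\<in>upper_half_plane. f u + g u) \<in> moderate_half_plane_funs"
proof -
  obtain n K where f: "f \<in> extensional upper_half_plane" "f holomorphic_on upper_half_plane" "n > 0"
    "\<And>a b. a \<le> b \<Longrightarrow> K a b \<ge> 0"
    "\<And>a b u. a \<le> b \<Longrightarrow> u \<in> upper_half_plane \<Longrightarrow> a \<le> Re u \<Longrightarrow> Re u \<le> b \<Longrightarrow>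
       cmod (f u) \<le> K a b * exp (2 * pi * real n * Im u)"
    by (rule moderate_half_plane_funsE[OF assms(1)], rule that)
  obtain m L where g: "g \<in> extensional upper_half_plane" "g holomorphic_on upper_half_plane" "m > 0"
    "\<And>a b. a \<le> b \<Longrightarrow> L a b \<ge> 0"
    "\<And>a b u. a \<le> b \<Longrightarrow> u \<in> upper_half_plane \<Longrightarrow> a \<le> Re u \<Longrightarrow> Re u \<le> b \<Longrightarrow>
       cmod (g u) \<le> L a b * exp (2 * pi * real m * Im u)"
    by (rule moderate_half_plane_funsE[OF assms(2)], rule that)
  show ?thesis
  proof (rule moderate_half_plane_funsI[where n = "n + m" and K = "\<lambda>a b. K a b + L a b"])
    show "(\<lambda>u\<in>upper_half_plane. f u + g u) holomorphic_on upper_half_plane"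
      by (rule holomorphic_transform[of "\<lambda>u. f u + g u"]) (auto intro!: holomorphic_intros f g)
    fix a b :: real and u assume ab: "a \<le> b" and u: "u \<in> upper_half_plane" "a \<le> Re u" "Re u \<le> b"
    then have y: "Im u > 0" by (simp add: upper_half_plane_def)
    have e: "exp (2 * pi * real n * Im u) \<le> exp (2 * pi * real (n + m) * Im u)"
      "exp (2 * pi * real m * Im u) \<le> exp (2 * pi * real (n + m) * Im u)"
      using y by (simp_all add: mult_right_mono)
    have "cmod (f u + g u) \<le> cmod (f u) + cmod (g u)" by (rule norm_triangle_ineq)
    also have "\<dots> \<le> K a b * exp (2 * pi * real n * Im u) + L a b * exp (2 * pi * real m * Im u)"
      by (intro add_mono f(5) g(5) ab u)
    also have "\<dots> \<le> K a b * exp (2 * pi * real (n + m) * Im u) + L a b * exp (2 * pi * real (n + m) * Im u)"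
      by (intro add_mono mult_left_mono e f(4) g(4) ab)
    finally show "cmod ((\<lambda>u\<in>upper_half_plane. f u + g u) u) \<le>
        (K a b + L a b) * exp (2 * pi * real (n + m) * Im u)"
      using u(1) by (simp add: distrib_right)
  qed (use f g in auto)
qed

lemma moderate_mult:
  assumes "f \<in> moderate_half_plane_funs" "g \<in> moderate_half_plane_funs"
  shows "(\<lambda>u\<in>upper_half_plane. f u * g u) \<in> moderate_half_plane_funs"
proof -
  obtain n K where f: "f \<in> extensional upper_half_plane" "f holomorphic_on upper_half_plane" "n > 0"
    "\<And>a b. a \<le> b \<Longrightarrow> K a b \<ge> 0"
    "\<And>a b u. a \<le> b \<Longrightarrow> u \<in> upper_half_plane \<Longrightarrow> a \<le> Re u \<Longrightarrow> Re u \<le> b \<Longrightarrow>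
       cmod (f u) \<le> K a b * exp (2 * pi * real n * Im u)"
    by (rule moderate_half_plane_funsE[OF assms(1)], rule that)
  obtain m L where g: "g \<in> extensional upper_half_plane" "g holomorphic_on upper_half_plane" "m > 0"
    "\<And>a b. a \<le> b \<Longrightarrow> L a b \<ge> 0"
    "\<And>a b u. a \<le> b \<Longrightarrow> u \<in> upper_half_plane \<Longrightarrow> a \<le> Re u \<Longrightarrow> Re u \<le> b \<Longrightarrow>
       cmod (g u) \<le> L a b * exp (2 * pi * real m * Im u)"
    by (rule moderate_half_plane_funsE[OF assms(2)], rule that)
  show ?thesis
  proof (rule moderate_half_plane_funsI[where n = "n + m" and K = "\<lambda>a b. K a b * L a b"])
    show "(\<lambda>u\<in>upper_half_plane. f u * g u) holomorphic_on upper_half_plane"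
      by (rule holomorphic_transform[of "\<lambda>u. f u * g u"]) (auto intro!: holomorphic_intros f g)
    fix a b :: real and u assume ab: "a \<le> b" and u: "u \<in> upper_half_plane" "a \<le> Re u" "Re u \<le> b"
    have "cmod (f u) * cmod (g u) \<le>
        (K a b * exp (2 * pi * real n * Im u)) * (L a b * exp (2 * pi * real m * Im u))"
      by (intro mult_mono f(5) g(5) ab u mult_nonneg_nonneg f(4) g(4)) auto
    also have "\<dots> = K a b * L a b * exp (2 * pi * real (n + m) * Im u)"
      by (simp add: distrib_left distrib_right exp_add)
    finally show "cmod ((\<lambda>u\<in>upper_half_plane. f u * g u) u) \<le>
        K a b * L a b * exp (2 * pi * real (n + m) * Im u)"
      using u(1) by (simp add: norm_mult)
  qed (use f g in auto)
qed

text \<open>Used to see that the binomials are moderate, as polynomials in the moderate function 2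
  pi i u.\<close>

lemma generated_subalgebra_moderate:
  assumes "G \<subseteq> moderate_half_plane_funs" "f \<in> generated_subalgebra upper_half_plane G"
  shows "f \<in> moderate_half_plane_funs"
  using assms(2)
  by induction (auto simp del: restrict_apply restrict_def
      intro: assms(1)[THEN subsetD] moderate_const moderate_add moderate_mult)

section \<open>The difference operator and binomials\<close>

definition shift_diff :: "(complex \<Rightarrow> complex) \<Rightarrow> complex \<Rightarrow> complex" where
  "shift_diff f = (\<lambda>u\<in>upper_half_plane. f (u + 1) - f u)"

text \<open>The shift moves the strip over [a, b] to the one over [a + 1, b + 1]: the exponent stays
  and only the constant changes.\<close>

lemma moderate_shift:
  assumes "f \<in> moderate_half_plane_funs"
  shows "(\<lambda>u\<in>upper_half_plane. f (u + 1)) \<in> moderate_half_plane_funs"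
proof -
  obtain n K where f: "f \<in> extensional upper_half_plane" "f holomorphic_on upper_half_plane" "n > 0"
    "\<And>a b. a \<le> b \<Longrightarrow> K a b \<ge> 0"
    "\<And>a b u. a \<le> b \<Longrightarrow> u \<in> upper_half_plane \<Longrightarrow> a \<le> Re u \<Longrightarrow> Re u \<le> b \<Longrightarrow>
       cmod (f u) \<le> K a b * exp (2 * pi * real n * Im u)"
    by (rule moderate_half_plane_funsE[OF assms(1)], rule that)
  show ?thesis
  proof (rule moderate_half_plane_funsI[where n = n and K = "\<lambda>a b. K (a + 1) (b + 1)"])
    have "(f \<circ> (\<lambda>u. u + 1)) holomorphic_on upper_half_plane"
      by (rule holomorphic_on_compose_gen[OF _ f(2)]) (auto intro!: holomorphic_intros)
    then show "(\<lambda>u\<in>upper_half_plane. f (u + 1)) holomorphic_on upper_half_plane"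
      by (rule holomorphic_transform) auto
    show "cmod ((\<lambda>u\<in>upper_half_plane. f (u + 1)) u) \<le> K (a + 1) (b + 1) * exp (2 * pi * real n * Im u)"
      if "a \<le> b" "u \<in> upper_half_plane" "a \<le> Re u" "Re u \<le> b" for a b u
      using f(5)[of "a + 1" "b + 1" "u + 1"] that by simp
  qed (use f in auto)
qed

lemma moderate_diff:
  assumes "f \<in> moderate_half_plane_funs" "g \<in> moderate_half_plane_funs"
  shows "(\<lambda>u\<in>upper_half_plane. f u - g u) \<in> moderate_half_plane_funs"
proof -
  have "(\<lambda>u\<in>upper_half_plane. f u + (\<lambda>u\<in>upper_half_plane. (\<lambda>u\<in>upper_half_plane. -1) u * g u) u)
      \<in> moderate_half_plane_funs"
    by (intro moderate_add moderate_mult moderate_const assms)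
  then show ?thesis by (rule back_subst[of "\<lambda>f. f \<in> _"]) auto
qed

lemma moderate_shift_diff: "f \<in> moderate_half_plane_funs \<Longrightarrow> shift_diff f \<in> moderate_half_plane_funs"
  using moderate_diff[OF moderate_shift] by (simp add: shift_diff_def cong: restrict_cong)

lemma shift_diff_funpow_diff:
  "(shift_diff ^^ n) (\<lambda>u\<in>upper_half_plane. f u - g u) =
     (\<lambda>u\<in>upper_half_plane. (shift_diff ^^ n) f u - (shift_diff ^^ n) g u)"
  by (induction n) (auto simp: shift_diff_def fun_eq_iff)

text \<open>The binomials \<open>u gchoose m\<close> are iterated primitives of 1 for the difference operator.\<close>

lemma shift_diff_funpow_gbinomial:
  assumes "\<And>u. u \<in> upper_half_plane \<Longrightarrow> h (u + 1) = h u" "k \<le> m"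
  shows "(shift_diff ^^ k) (\<lambda>u\<in>upper_half_plane. (u gchoose m) * h u) =
    (\<lambda>u\<in>upper_half_plane. (u gchoose (m - k)) * h u)"
  using assms(2)
proof (induction k)
  case (Suc k)
  \<comment> \<open>Pascal's rule; periodicity of \<open>h\<close> then lets it factor out of the
    difference.\<close>
  have "(u + 1 gchoose (m - k)) - (u gchoose (m - k)) = u gchoose (m - Suc k)" for u :: complex
    using gbinomial_Suc_Suc[of u "m - Suc k"] Suc.prems by (simp add: Suc_diff_Suc)
  then show ?case
    using Suc assms(1) by (auto simp: shift_diff_def fun_eq_iff simp flip: left_diff_distrib)
qed simp

text \<open>The set \<open>G\<close> stays free because the lemma serves twice: with
  \<open>{}\<close> to show that the binomials are moderate, and with the pulled back meromorphic
  functions to place them in \<open>log_disc_funs\<close>.\<close>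

lemma gbinomial_in_generated_subalgebra:
  "(\<lambda>u\<in>upper_half_plane. u gchoose m) \<in>
    generated_subalgebra upper_half_plane (insert (\<lambda>u\<in>upper_half_plane. 2 * of_real pi * \<i> * u) G)"
    (is "_ \<in> ?A")
proof (induction m)
  case 0
  have "(\<lambda>u\<in>upper_half_plane. (u :: complex) gchoose 0) = (\<lambda>u\<in>upper_half_plane. 1)" by simp
  then show ?case by (simp only: generated_subalgebra.const)
next
  case (Suc m)
  \<comment> \<open>\<open>b\<close> and \<open>d\<close> write the factor (u - m)/(m + 1), which
    leads from one binomial to the next, as an affine function of the generator 2 pi i u.\<close>
  define b :: complex where "b = 1 / (2 * of_real pi * \<i> * of_nat (Suc m))"
  define d :: complex where "d = - of_nat m / of_nat (Suc m)"
  have "(\<lambda>u\<in>upper_half_plane. 2 * of_real pi * \<i> * u) \<in> ?A"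
    by (rule generated_subalgebra.gen) simp
  from generated_subalgebra.mult[OF Suc generated_subalgebra.add[OF
      generated_subalgebra.mult[OF generated_subalgebra.const[where c = b] this]
      generated_subalgebra.const[where c = d]]]
  have "(\<lambda>u\<in>upper_half_plane. (u gchoose m) * (b * (2 * of_real pi * \<i> * u) + d)) \<in> ?A"
    by (simp cong: restrict_cong)
  moreover have "u gchoose Suc m = (u gchoose m) * (b * (2 * of_real pi * \<i> * u) + d)" for u :: complex
  proof -
    have "u gchoose Suc m = (u gchoose m) * ((u - of_nat m) / of_nat (Suc m))"
      by (simp add: gbinomial_prod_rev)
    also have "(u - of_nat m) / of_nat (Suc m) = b * (2 * of_real pi * \<i> * u) + d"
      by (simp add: b_def d_def diff_divide_distrib)
    finally show ?thesis .
  qed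
  ultimately show ?case by (simp only:)
qed

section \<open>Periodic moderate functions on the punctured disc\<close>

lemma periodic_add_int:
  assumes "\<And>u. u \<in> upper_half_plane \<Longrightarrow> f (u + 1) = f u" "u \<in> upper_half_plane"
  shows "f (u + of_int k) = f u"
proof -
  have nat: "f (u + of_nat n) = f u" if "u \<in> upper_half_plane" for n u
  proof (induction n)
    case (Suc n)
    have "u + of_nat n \<in> upper_half_plane" using that by (simp add: upper_half_plane_def)
    then show ?case using assms(1)[of "u + of_nat n"] Suc by (simp add: algebra_simps)
  qed simp
  show ?thesis
  proof (cases k)
    case (nonneg n)
    then show ?thesis using nat[OF assms(2)] by simp
  next
    case (neg n)
    have "u + of_int k \<in> upper_half_plane" using assms(2) by (simp add: upper_half_plane_def)
    moreover have "u + of_int k + of_nat (Suc n) = u" using neg by simp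
    ultimately show ?thesis using nat[of "u + of_int k" "Suc n"] by metis
  qed
qed

text \<open>Periodicity lets \<open>f\<close> descend to the punctured disc. With z = e(u) one has
  |z|^n exp(2 pi n Im u) = 1, so the growth bound says that z^n times the descended function is
  bounded, and the singularity at 0 is removable.\<close>

lemma periodic_moderate_in_log_disc_funs:
  assumes f: "f \<in> moderate_half_plane_funs"
    and periodic: "\<And>u. u \<in> upper_half_plane \<Longrightarrow> f (u + 1) = f u"
  shows "f \<in> log_disc_funs"
proof -
  obtain n K where fn: "f \<in> extensional upper_half_plane" "f holomorphic_on upper_half_plane" "n > 0"
    "\<And>a b. a \<le> b \<Longrightarrow> K a b \<ge> 0"
    "\<And>a b u. a \<le> b \<Longrightarrow> u \<in> upper_half_plane \<Longrightarrow> a \<le> Re u \<Longrightarrow> Re u \<le> b \<Longrightarrow>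
       cmod (f u) \<le> K a b * exp (2 * pi * real n * Im u)"
    by (rule moderate_half_plane_funsE[OF f], rule that)
  define l where "l z = Ln z / (2 * of_real pi * \<i>)" for z
  \<comment> \<open>A second branch of the logarithm, cut along the nonnegative reals where
    \<open>l\<close> is cut along the nonpositive ones; it inverts \<open>expcov\<close> because
    exp(pi i) = -1. The two slit discs cover the punctured disc.\<close>
  define l2 where "l2 z = (Ln (- z) + of_real pi * \<i>) / (2 * of_real pi * \<i>)" for z
  have exp_l: "expcov (l z) = z" "expcov (l2 z) = z" if "z \<noteq> 0" for z
    using that by (simp_all add: expcov_def l_def l2_def exp_add)
  have norm_exp: "cmod (expcov u) = exp (- 2 * pi * Im u)" for u
    by (simp add: expcov_def)
  have UHP: "u \<in> upper_half_plane" if "expcov u = z" "z \<in> punctured_disc" for u z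
  proof -
    have "exp (- 2 * pi * Im u) < 1" using that norm_exp[of u] by auto
    then show ?thesis by (simp add: upper_half_plane_def zero_less_mult_iff)
  qed
  have l_UHP: "l z \<in> upper_half_plane" "l2 z \<in> upper_half_plane" if "z \<in> punctured_disc" for z
    using UHP[OF exp_l(1) that] UHP[OF exp_l(2) that] that by auto
  have feq: "f u = f v" if uv: "expcov u = expcov v" "v \<in> upper_half_plane" for u v
  proof -
    obtain k :: int where "2 * of_real pi * \<i> * u = 2 * of_real pi * \<i> * v + (of_int (2 * k) * pi) * \<i>"
      using uv(1) unfolding expcov_def exp_eq by blast
    then have "2 * of_real pi * \<i> * u = 2 * of_real pi * \<i> * (v + of_int k)"
      by (simp add: algebra_simps)
    then have "u = v + of_int k" by simp
    then show ?thesis using periodic_add_int[of f, OF periodic uv(2)] by simp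
  qed
  define m where "m = (\<lambda>z\<in>punctured_disc. f (l z))"
  \<comment> \<open>Any logarithm of z computes \<open>m\<close>, so holomorphy may be checked with
    whichever branch is holomorphic nearby.\<close>
  have m: "m z = f u" if "expcov u = z" "z \<in> punctured_disc" for u z
    using that feq[of "l z" u] UHP[OF that] exp_l[of z] by (auto simp: m_def)
  have hol1: "(f \<circ> l) holomorphic_on punctured_disc - \<real>\<^sub>\<le>\<^sub>0"
  proof (rule holomorphic_on_compose_gen[OF _ fn(2)])
    show "l holomorphic_on punctured_disc - \<real>\<^sub>\<le>\<^sub>0"
      by (auto simp: l_def[abs_def] intro!: holomorphic_intros)
    show "l ` (punctured_disc - \<real>\<^sub>\<le>\<^sub>0) \<subseteq> upper_half_plane" using l_UHP by blast
  qed
  have hol2: "(f \<circ> l2) holomorphic_on punctured_disc - \<real>\<^sub>\<ge>\<^sub>0"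
  proof (rule holomorphic_on_compose_gen[OF _ fn(2)])
    have "- z \<notin> \<real>\<^sub>\<le>\<^sub>0" if "z \<notin> \<real>\<^sub>\<ge>\<^sub>0" for z :: complex
      using that by (auto simp: complex_nonpos_Reals_iff complex_nonneg_Reals_iff)
    then show "l2 holomorphic_on punctured_disc - \<real>\<^sub>\<ge>\<^sub>0"
      by (auto simp: l2_def[abs_def] intro!: holomorphic_intros)
    show "l2 ` (punctured_disc - \<real>\<^sub>\<ge>\<^sub>0) \<subseteq> upper_half_plane" using l_UHP by blast
  qed
  have "m holomorphic_on (punctured_disc - \<real>\<^sub>\<le>\<^sub>0) \<union> (punctured_disc - \<real>\<^sub>\<ge>\<^sub>0)"
  proof (rule holomorphic_on_Un)
    show "m holomorphic_on punctured_disc - \<real>\<^sub>\<le>\<^sub>0"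
      by (rule holomorphic_transform[OF hol1]) (auto simp: m_def)
    show "m holomorphic_on punctured_disc - \<real>\<^sub>\<ge>\<^sub>0"
      by (rule holomorphic_transform[OF hol2]) (simp add: m[OF exp_l(2)])
  qed (auto intro!: open_Diff)
  moreover have "punctured_disc \<subseteq> (punctured_disc - \<real>\<^sub>\<le>\<^sub>0) \<union> (punctured_disc - \<real>\<^sub>\<ge>\<^sub>0)"
    by (auto simp: complex_nonpos_Reals_iff complex_nonneg_Reals_iff complex_eq_iff)
  ultimately have m_hol: "m holomorphic_on punctured_disc"
    using holomorphic_on_subset by blast
  have bound: "cmod (z ^ n * m z) \<le> K (-1) 1" if z: "z \<in> punctured_disc" for z
  proof -
    have z0: "z \<noteq> 0" using z by auto
    have u: "l z \<in> upper_half_plane" using l_UHP z by blast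
    have "2 * of_real pi * \<i> * l z = Ln z" by (simp add: l_def)
    \<comment> \<open>The principal branch keeps 2 Re (l z) in (-1, 1], so every value of
      \<open>l\<close> lies in the strip over [-1, 1] and the single constant
      \<open>K (-1) 1\<close> serves for all z.\<close>
    from arg_cong[OF this, of Im] have "pi * (2 * Re (l z)) = Im (Ln z)" by simp
    then have "pi * - 1 < pi * (2 * Re (l z))" "pi * (2 * Re (l z)) \<le> pi * 1"
      using mpi_less_Im_Ln[OF z0] Im_Ln_le_pi[OF z0] by simp_all
    then have "- 1 \<le> Re (l z)" "Re (l z) \<le> 1"
      by (simp_all only: mult_less_cancel_left_pos[OF pi_gt_zero] mult_le_cancel_left_pos[OF pi_gt_zero])
    then have "cmod (m z) \<le> K (-1) 1 * exp (2 * pi * real n * Im (l z))"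
      using fn(5)[of "-1" 1 "l z"] u m[OF exp_l(1)[OF z0] z] by simp
    also have "exp (2 * pi * real n * Im (l z)) = 1 / cmod z ^ n"
    proof -
      have "cmod z * exp (2 * pi * Im (l z)) = 1"
        using norm_exp[of "l z"] exp_l(1)[OF z0] by (simp add: exp_minus field_simps)
      then have "cmod z ^ n * exp (2 * pi * Im (l z)) ^ n = 1"
        by (metis power_mult_distrib power_one)
      moreover have "exp (2 * pi * Im (l z)) ^ n = exp (2 * pi * real n * Im (l z))"
        by (simp flip: exp_of_nat_mult add: mult_ac)
      ultimately show ?thesis using z0 by (simp add: field_simps)
    qed
    finally show ?thesis using z0 by (simp add: norm_mult norm_power field_simps)
  qed
  have "\<exists>g. g holomorphic_on disc \<and> (\<forall>z\<in>disc - {0}. g z = z ^ n * m z)"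
  proof (rule holomorphic_on_extend_bounded[THEN iffD2])
    show "(\<lambda>z. z ^ n * m z) holomorphic_on punctured_disc"
      by (intro holomorphic_intros m_hol)
    have "eventually (\<lambda>z. z \<in> disc) (nhds (0::complex))"
      by (rule eventually_nhds_in_open) auto
    then have "eventually (\<lambda>z. cmod (z ^ n * m z) \<le> K (-1) 1) (at 0)"
      unfolding eventually_at_filter by eventually_elim (use bound in auto)
    then show "\<exists>B. eventually (\<lambda>z. cmod (z ^ n * m z) \<le> B) (at 0)" by blast
  qed auto
  then have "m \<in> meromorphic_disc_funs"
    using m_hol by (auto simp: meromorphic_disc_funs_def hol_funs_plane m_def)
  moreover have "f = pullback upper_half_plane expcov m"
  proof
    fix u show "f u = pullback upper_half_plane expcov m u"
    proof (cases "u \<in> upper_half_plane")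
      case True
      then have "expcov u \<in> punctured_disc"
        using norm_exp[of u] by (auto simp: expcov_def upper_half_plane_def)
      then show ?thesis using True m by (simp add: pullback_def)
    next
      case False
      then show ?thesis using fn(1) by (simp add: pullback_def extensional_def)
    qed
  qed
  ultimately show ?thesis
    unfolding log_disc_funs_def by (intro generated_subalgebra.gen) blast
qed

lemma shift_nilpotent_moderate_in_log_disc_funs:
  assumes "f \<in> moderate_half_plane_funs" "(shift_diff ^^ n) f = (\<lambda>u\<in>upper_half_plane. 0)"
  shows "f \<in> log_disc_funs"
  using assms
proof (induction n arbitrary: f)
  case 0
  have "f = (\<lambda>u\<in>upper_half_plane. 0)" using 0(2) by (simp only: funpow.simps id_apply)
  then show ?case unfolding log_disc_funs_def by (simp only: generated_subalgebra.const)
next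
  case (Suc n)
  define h where "h = (shift_diff ^^ n) f"
  define b where "b = (\<lambda>u\<in>upper_half_plane. (u :: complex) gchoose n)"
  have h: "h \<in> moderate_half_plane_funs"
    unfolding h_def by (induction n) (auto intro: Suc.prems moderate_shift_diff)
  have periodic: "h (u + 1) = h u" if "u \<in> upper_half_plane" for u
  proof -
    have "shift_diff h = (\<lambda>u\<in>upper_half_plane. 0)"
      using Suc.prems(2) by (simp only: h_def funpow.simps comp_apply)
    then have "shift_diff h u = 0" using that by simp
    then show ?thesis using that by (simp add: shift_diff_def)
  qed
  have b: "b \<in> moderate_half_plane_funs"
    unfolding b_def
    by (rule generated_subalgebra_moderate[OF _ gbinomial_in_generated_subalgebra[of _ "{}"]])
       (use moderate_scaled_id in auto)
  define bh where "bh = (\<lambda>u\<in>upper_half_plane. b u * h u)"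
  define r where "r = (\<lambda>u\<in>upper_half_plane. f u - bh u)"
  \<comment> \<open>With \<open>k = m = n\<close> the remaining binomial is
    \<open>u gchoose 0\<close> = 1, so the n-th difference of \<open>bh\<close> is exactly that of
    \<open>f\<close>.\<close>
  have "(shift_diff ^^ n) bh = (\<lambda>u\<in>upper_half_plane. h u)"
    using shift_diff_funpow_gbinomial[of h n n] periodic by (simp add: bh_def b_def cong: restrict_cong)
  then have "(shift_diff ^^ n) r = (\<lambda>u\<in>upper_half_plane. 0)"
    unfolding r_def shift_diff_funpow_diff by (auto simp: h_def)
  moreover have "r \<in> moderate_half_plane_funs"
    unfolding r_def bh_def by (intro moderate_diff moderate_mult Suc.prems b h)
  ultimately have "r \<in> log_disc_funs" by (intro Suc.IH)
  moreover have "h \<in> log_disc_funs"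
    by (rule periodic_moderate_in_log_disc_funs[OF h periodic])
  moreover have "b \<in> log_disc_funs"
    unfolding b_def log_disc_funs_def by (rule gbinomial_in_generated_subalgebra)
  ultimately have "(\<lambda>u\<in>upper_half_plane. r u + (\<lambda>u\<in>upper_half_plane. b u * h u) u) \<in> log_disc_funs"
    unfolding log_disc_funs_def by (intro generated_subalgebra.add generated_subalgebra.mult)
  moreover have "f \<in> extensional upper_half_plane"
    using Suc.prems(1) by (simp add: moderate_half_plane_funs_iff)
  ultimately show ?case
    by (auto elim!: back_subst[of "\<lambda>f. f \<in> _"] simp: r_def bh_def extensional_def fun_eq_iff)
qed

section \<open>The action of the group algebra\<close>

text \<open>Allows summing over a convenient finite set when cancellation makes the exact support
  awkward, as for products.\<close>

lemma group_algebra_act_superset: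
  assumes "finite F" "{g. a g \<noteq> 0} \<subseteq> F" "x \<in> M"
  shows "group_algebra_act M f a x = (\<Sum>g\<in>F. a g * f (g x))"
  unfolding group_algebra_act_def using assms by (auto intro!: sum.mono_neutral_left)

text \<open>The element \<gamma> - 1. As a difference of two indicator functions it is also correct
  when \<gamma> is the unit, where it is 0.\<close>

definition group_algebra_diff :: "('g, 'm) monoid_scheme \<Rightarrow> 'g \<Rightarrow> 'g \<Rightarrow> complex" where
  "group_algebra_diff G \<gamma> = (\<lambda>g. (if g = \<gamma> then 1 else 0) - (if g = \<one>\<^bsub>G\<^esub> then 1 else 0))"

lemma group_algebra_diff_in_augmentation_ideal:
  assumes "group G" "\<gamma> \<in> carrier G"
  shows "group_algebra_diff G \<gamma> \<in> augmentation_ideal G"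
proof -
  interpret group G by fact
  let ?b = "group_algebra_diff G \<gamma>"
  have supp: "{g. ?b g \<noteq> 0} \<subseteq> {\<gamma>, \<one>\<^bsub>G\<^esub>}" by (auto simp: group_algebra_diff_def)
  then have "(\<Sum>g | ?b g \<noteq> 0. ?b g) = (\<Sum>g\<in>{\<gamma>, \<one>\<^bsub>G\<^esub>}. ?b g)"
    by (intro sum.mono_neutral_left) auto
  also have "\<dots> = 0" by (cases "\<gamma> = \<one>\<^bsub>G\<^esub>") (auto simp: group_algebra_diff_def)
  finally show ?thesis
    using supp assms(2) finite_subset[OF supp] by (auto simp: augmentation_ideal_def group_algebra_def)
qed

text \<open>Since (h\<gamma>)(x) = h(\<gamma>(x)), a factor \<gamma> on the right changes only the
  point at which the sum for \<open>a\<close> is evaluated.\<close>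

lemma group_algebra_mult_diff:
  assumes G: "group G" and \<gamma>: "\<gamma> \<in> carrier G" and a: "a \<in> carrier (group_algebra G)"
    and act: "\<And>h x. h \<in> carrier G \<Longrightarrow> x \<in> M \<Longrightarrow> (h \<otimes>\<^bsub>G\<^esub> \<gamma>) x = h (\<gamma> x)"
    and \<gamma>M: "\<gamma> \<in> M \<rightarrow> M"
  shows "a \<otimes>\<^bsub>group_algebra G\<^esub> group_algebra_diff G \<gamma> \<in> carrier (group_algebra G)" (is "?c \<in> _")
    and "x \<in> M \<Longrightarrow> group_algebra_act M f (a \<otimes>\<^bsub>group_algebra G\<^esub> group_algebra_diff G \<gamma>) x =
      group_algebra_act M f a (\<gamma> x) - group_algebra_act M f a x"
proof -
  interpret group G by fact
  define S where "S = {h. a h \<noteq> 0}"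
  have S: "finite S" "S \<subseteq> carrier G" using a by (auto simp: S_def group_algebra_def)
  \<comment> \<open>Contains the supports of both \<open>a\<close> \<gamma> and \<open>a\<close>,
    hence that of their difference.\<close>
  define F where "F = (\<lambda>h. h \<otimes>\<^bsub>G\<^esub> \<gamma>) ` S \<union> S"
  have F: "finite F" "F \<subseteq> carrier G" using S \<gamma> by (auto simp: F_def)
  have solve: "inv\<^bsub>G\<^esub> h \<otimes>\<^bsub>G\<^esub> g = k \<longleftrightarrow> g = h \<otimes>\<^bsub>G\<^esub> k"
    if "h \<in> carrier G" "g \<in> carrier G" "k \<in> carrier G" for h g k
    using that by (metis inv_closed inv_solve_left' inv_inv m_closed inv_solve_left)
  have c: "?c g = (\<Sum>h\<in>S. a h * ((if g = h \<otimes>\<^bsub>G\<^esub> \<gamma> then 1 else 0) - (if g = h then 1 else 0)))"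
    if g: "g \<in> carrier G" for g
  proof -
    have "?c g = (\<Sum>h\<in>S. a h * group_algebra_diff G \<gamma> (inv\<^bsub>G\<^esub> h \<otimes>\<^bsub>G\<^esub> g))"
      using g by (simp add: group_algebra_def S_def)
    also have "\<dots> = (\<Sum>h\<in>S. a h * ((if g = h \<otimes>\<^bsub>G\<^esub> \<gamma> then 1 else 0) - (if g = h then 1 else 0)))"
    proof (rule sum.cong)
      fix h assume "h \<in> S"
      then have h: "h \<in> carrier G" using S by blast
      show "a h * group_algebra_diff G \<gamma> (inv\<^bsub>G\<^esub> h \<otimes>\<^bsub>G\<^esub> g) =
          a h * ((if g = h \<otimes>\<^bsub>G\<^esub> \<gamma> then 1 else 0) - (if g = h then 1 else 0))"
        using solve[OF h g \<gamma>] solve[OF h g one_closed] h by (simp add: group_algebra_diff_def)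
    qed simp
    finally show ?thesis .
  qed
  have supp: "{g. ?c g \<noteq> 0} \<subseteq> F"
  proof
    fix g assume "g \<in> {g. ?c g \<noteq> 0}"
    then have nz: "?c g \<noteq> 0" by simp
    then have g: "g \<in> carrier G" by (auto simp: group_algebra_def split: if_splits)
    show "g \<in> F"
    proof (rule ccontr)
      assume "g \<notin> F"
      then have "?c g = 0" unfolding c[OF g] by (intro sum.neutral) (auto simp: F_def)
      then show False using nz by simp
    qed
  qed
  then show "?c \<in> carrier (group_algebra G)"
    using F finite_subset[OF supp] by (auto simp: group_algebra_def)
  assume x: "x \<in> M"
  then have \<gamma>x: "\<gamma> x \<in> M" using \<gamma>M by auto
  have "group_algebra_act M f ?c x = (\<Sum>g\<in>F. ?c g * f (g x))"
    by (rule group_algebra_act_superset[OF F(1) supp x])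
  also have "\<dots> = (\<Sum>g\<in>F. \<Sum>h\<in>S. a h * ((if g = h \<otimes>\<^bsub>G\<^esub> \<gamma> then 1 else 0) - (if g = h then 1 else 0)) * f (g x))"
    using F(2) by (intro sum.cong) (auto simp: c sum_distrib_right)
  also have "\<dots> = (\<Sum>h\<in>S. \<Sum>g\<in>F. a h * ((if g = h \<otimes>\<^bsub>G\<^esub> \<gamma> then 1 else 0) - (if g = h then 1 else 0)) * f (g x))"
    by (rule sum.swap)
  also have "\<dots> = (\<Sum>h\<in>S. a h * f (h (\<gamma> x)) - a h * f (h x))"
  proof (rule sum.cong)
    fix h assume h: "h \<in> S"
    then have hF: "h \<otimes>\<^bsub>G\<^esub> \<gamma> \<in> F" "h \<in> F" by (auto simp: F_def)
    have "(\<Sum>g\<in>F. a h * ((if g = h \<otimes>\<^bsub>G\<^esub> \<gamma> then 1 else 0) - (if g = h then 1 else 0)) * f (g x)) =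
        (\<Sum>g\<in>F. (if g = h \<otimes>\<^bsub>G\<^esub> \<gamma> then a h * f (g x) else 0) - (if g = h then a h * f (g x) else 0))"
      by (rule sum.cong) (auto simp: algebra_simps)
    also have "\<dots> = a h * f ((h \<otimes>\<^bsub>G\<^esub> \<gamma>) x) - a h * f (h x)"
      using hF F(1) by (simp add: sum_subtractf)
    also have "(h \<otimes>\<^bsub>G\<^esub> \<gamma>) x = h (\<gamma> x)" using act[OF _ x] h S by blast
    finally show "(\<Sum>g\<in>F. a h * ((if g = h \<otimes>\<^bsub>G\<^esub> \<gamma> then 1 else 0) - (if g = h then 1 else 0)) * f (g x)) =
        a h * f (h (\<gamma> x)) - a h * f (h x)" .
  qed simp
  also have "\<dots> = group_algebra_act M f a (\<gamma> x) - group_algebra_act M f a x"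
    using S(1) x \<gamma>x by (simp add: group_algebra_act_superset[of S] S_def sum_subtractf)
  finally show "group_algebra_act M f ?c x = group_algebra_act M f a (\<gamma> x) - group_algebra_act M f a x" .
qed

text \<open>Multiplies on the right, as \<open>ideal_power\<close> does, so that membership in the
  ideal power follows step by step.\<close>

primrec group_algebra_diff_power :: "('g, 'm) monoid_scheme \<Rightarrow> 'g \<Rightarrow> nat \<Rightarrow> 'g \<Rightarrow> complex" where
  "group_algebra_diff_power G \<gamma> 0 = \<one>\<^bsub>group_algebra G\<^esub>"
| "group_algebra_diff_power G \<gamma> (Suc n) =
     group_algebra_diff_power G \<gamma> n \<otimes>\<^bsub>group_algebra G\<^esub> group_algebra_diff G \<gamma>"

lemma group_algebra_one_closed:
  assumes "group G"
  shows "\<one>\<^bsub>group_algebra G\<^esub> \<in> carrier (group_algebra G)"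
  using group.is_monoid[OF assms] by (simp add: group_algebra_def monoid.one_closed)

lemma group_algebra_diff_power_in_ideal_power:
  assumes "group G" "\<gamma> \<in> carrier G"
  shows "group_algebra_diff_power G \<gamma> n \<in> ideal_power (group_algebra G) (augmentation_ideal G) n"
  by (induction n)
     (auto intro: ideal_prod.prod group_algebra_one_closed[OF assms(1)]
       group_algebra_diff_in_augmentation_ideal[OF assms])

text \<open>Pulled back along \<psi>, replacing x by \<gamma>(x) becomes u \<mapsto> u + 1, so each
  right factor \<gamma> - 1 is one application of \<open>shift_diff\<close>.\<close>

lemma act_diff_power_eq_shift_diff:
  assumes G: "group G" and \<gamma>: "\<gamma> \<in> carrier G"
    and act: "\<And>h x. h \<in> carrier G \<Longrightarrow> x \<in> M \<Longrightarrow> (h \<otimes>\<^bsub>G\<^esub> \<gamma>) x = h (\<gamma> x)"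
    and one: "\<And>x. x \<in> M \<Longrightarrow> \<one>\<^bsub>G\<^esub> x = x" and \<gamma>M: "\<gamma> \<in> M \<rightarrow> M"
    and \<psi>: "\<And>u. u \<in> upper_half_plane \<Longrightarrow> \<psi> u \<in> M" "\<And>u. u \<in> upper_half_plane \<Longrightarrow> \<gamma> (\<psi> u) = \<psi> (u + 1)"
  shows "(shift_diff ^^ n) (pullback upper_half_plane \<psi> f) =
    pullback upper_half_plane \<psi> (group_algebra_act M f (group_algebra_diff_power G \<gamma> n))"
proof -
  have closed: "group_algebra_diff_power G \<gamma> n \<in> carrier (group_algebra G)" for n
    by (induction n) (auto intro: group_algebra_one_closed[OF G] group_algebra_mult_diff(1)[OF G \<gamma> _ act \<gamma>M])
  show ?thesis
  proof (induction n)
    case 0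
    have "group_algebra_act M f \<one>\<^bsub>group_algebra G\<^esub> x = f x" if "x \<in> M" for x
      using group_algebra_act_superset[of "{\<one>\<^bsub>G\<^esub>}" "\<one>\<^bsub>group_algebra G\<^esub>" x M f] that one
      by (simp add: group_algebra_def)
    then show ?case using \<psi>(1) by (simp add: pullback_def fun_eq_iff)
  next
    case (Suc n)
    show ?case
    proof
      fix u
      show "(shift_diff ^^ Suc n) (pullback upper_half_plane \<psi> f) u =
          pullback upper_half_plane \<psi> (group_algebra_act M f (group_algebra_diff_power G \<gamma> (Suc n))) u"
      proof (cases "u \<in> upper_half_plane")
        case True
        have "(shift_diff ^^ Suc n) (pullback upper_half_plane \<psi> f) u =
            group_algebra_act M f (group_algebra_diff_power G \<gamma> n) (\<psi> (u + 1)) -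
            group_algebra_act M f (group_algebra_diff_power G \<gamma> n) (\<psi> u)"
          unfolding funpow.simps comp_apply Suc using True by (simp add: shift_diff_def pullback_def)
        also have "\<dots> = group_algebra_act M f (group_algebra_diff_power G \<gamma> (Suc n)) (\<psi> u)"
          using group_algebra_mult_diff(2)[OF G \<gamma> closed[of n] act \<gamma>M \<psi>(1)[OF True], where f = f]
            \<psi>(2)[OF True] by simp
        finally show ?thesis using True by (simp add: pullback_def)
      next
        case False
        then show ?thesis by (simp add: shift_diff_def pullback_def)
      qed
    qed
  qed
qed

section \<open>Unipotent functions on the lifted punctured discs\<close>

theorem proposition7p2:
  fixes C :: "(complex ^ 'n) set"
    and Cbar :: "'b::t2_space set" and Abar :: "'b atlas" and j :: "complex ^ 'n \<Rightarrow> 'b"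
    and Ct :: "'a::t2_space set" and At :: "'a atlas" and p :: "'a \<Rightarrow> complex ^ 'n"
    and S :: "'b set"
    and \<phi> :: "'b \<Rightarrow> complex \<Rightarrow> 'b"
    and X :: "'b \<Rightarrow> 'a set set"
    and \<phi>t :: "'b \<Rightarrow> 'a set \<Rightarrow> complex \<Rightarrow> 'a"
  assumes curve: "smooth_connected_affine_curve C"
    and cover: "universal_cover Ct At C (affine_curve_atlas C) p"
    and compactification: "smooth_compactification C (affine_curve_atlas C) Cbar Abar j"
    and S: "S = Cbar - j ` C"
    and \<phi>_holo: "\<And>s. s \<in> S \<Longrightarrow> holo_map disc (plane_atlas disc) Cbar Abar (\<phi> s)"
    and \<phi>_inj: "\<And>s. s \<in> S \<Longrightarrow> inj_on (\<phi> s) disc"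
    and \<phi>_0: "\<And>s. s \<in> S \<Longrightarrow> \<phi> s 0 = s"
    and \<phi>_S: "\<And>s. s \<in> S \<Longrightarrow> \<phi> s ` disc \<inter> S = {s}"
    and X: "\<And>s. s \<in> S \<Longrightarrow> X s = puncture_components Ct p j (\<phi> s)"
    and \<phi>t_holo: "\<And>s x. s \<in> S \<Longrightarrow> x \<in> X s \<Longrightarrow>
           holo_map upper_half_plane (plane_atlas upper_half_plane) Ct At (\<phi>t s x)"
    and \<phi>t_comp: "\<And>s x. s \<in> S \<Longrightarrow> x \<in> X s \<Longrightarrow> \<phi>t s x ` upper_half_plane \<subseteq> x"
    and \<phi>t_lift: "\<And>s x u. s \<in> S \<Longrightarrow> x \<in> X s \<Longrightarrow> u \<in> upper_half_plane \<Longrightarrow>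
           j (p (\<phi>t s x u)) = \<phi> s (expcov u)"
  shows "puncture_pullback S X \<phi>t ` filtration_moderate_infinity Ct At p S X \<phi>t
           \<subseteq> (\<Pi>\<^sub>E s\<in>S. \<Pi>\<^sub>E x\<in>X s. log_disc_funs)"
proof -
  have cov: "covering_space Ct p C" and sc: "simply_connected Ct"
    and hc: "holomorphic_covering Ct At C (affine_curve_atlas C) p"
  proof -
    show "covering_space Ct p C" "simply_connected Ct"
      using cover by (auto simp: universal_cover_def)
    show "holomorphic_covering Ct At C (affine_curve_atlas C) p"
    proof
      show "\<exists>U \<phi>. (U, \<phi>) \<in> affine_curve_atlas C \<and> x \<in> U" if "x \<in> C" for x
        by (rule affine_curve_atlas_covers[OF curve that compactification]) blast
    qed (use cover in \<open>auto simp: universal_cover_def affine_curve_atlas_def\<close>)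
  qed
  interpret holomorphic_covering Ct At C "affine_curve_atlas C" p by (rule hc)
  have pC: "p y \<in> C" if "y \<in> Ct" for y
    using covering_space_imp_surjective[OF cov] that by blast
  obtain k where k: "homeomorphism C (j ` C) j k"
    using compactification by (auto simp: smooth_compactification_def)
  \<comment> \<open>The lifts are prescribed in the compactification; injectivity of
    \<open>j\<close> brings the equality of projections back to \<open>C\<close>, where the covering
    lives.\<close>
  have inj_j: "inj_on j C"
    by (rule inj_on_inverseI[of _ k], rule homeomorphism_apply1[OF k])
  have "pullback upper_half_plane (\<phi>t s x) f \<in> log_disc_funs"
    if s: "s \<in> S" and x: "x \<in> X s" and f: "f \<in> filtration_moderate Ct At p S X \<phi>t n" for s x f n
  proof -
    let ?G = "deck_group Ct At p"
    let ?\<psi> = "\<phi>t s x"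
    have \<psi>: "?\<psi> \<in> upper_half_plane \<rightarrow> Ct" "continuous_on upper_half_plane ?\<psi>"
      using \<phi>t_holo[OF s x] by (auto simp: holo_map_def)
    have shift: "p (?\<psi> (u + 1)) = p (?\<psi> u)" if u: "u \<in> upper_half_plane" for u
    proof -
      have "expcov (u + 1) = expcov u" by (simp add: expcov_def distrib_left exp_add)
      then have "j (p (?\<psi> (u + 1))) = j (p (?\<psi> u))"
        using \<phi>t_lift[OF s x] u by simp
      then show ?thesis
        using inj_onD[OF inj_j _ pC pC, of "?\<psi> (u + 1)" "?\<psi> u"] \<psi>(1) u by (auto simp: Pi_iff)
    qed
    have i: "\<i> \<in> upper_half_plane" by (simp add: upper_half_plane_def)
    then have \<psi>i: "?\<psi> \<i> \<in> Ct" "?\<psi> (\<i> + 1) \<in> Ct"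
      using \<psi>(1) by (auto simp: Pi_iff)
    obtain \<gamma> where \<gamma>: "\<gamma> \<in> carrier ?G" "\<gamma> (?\<psi> \<i>) = ?\<psi> (\<i> + 1)"
      by (rule deck_transitive[OF sc \<psi>i shift[OF i, symmetric]], rule that)
    have \<gamma>': "continuous_on Ct \<gamma>" "\<gamma> \<in> Ct \<rightarrow> Ct" "\<And>y. y \<in> Ct \<Longrightarrow> p (\<gamma> y) = p y"
      using \<gamma>(1) by (auto simp: deck_carrier_iff Bij_def bij_betw_def)
    have conn: "connected upper_half_plane"
      unfolding upper_half_plane_def by (rule convex_connected, rule convex_halfspace_Im_gt)
    \<comment> \<open>Both sides have the same projection to \<open>C\<close> and agree at
      \<open>\<i>\<close> by the choice of \<gamma>.\<close>
    have \<gamma>\<psi>: "\<gamma> (?\<psi> u) = ?\<psi> (u + 1)" if u: "u \<in> upper_half_plane" for u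
    proof (rule covering_lift_unique[OF cov conn i, of "\<lambda>u. \<gamma> (?\<psi> u)" "\<lambda>u. ?\<psi> (u + 1)" u])
      show "continuous_on upper_half_plane (\<lambda>u. \<gamma> (?\<psi> u))"
        by (rule continuous_on_compose2[OF \<gamma>'(1) \<psi>(2)]) (use \<psi>(1) in auto)
      show "continuous_on upper_half_plane (\<lambda>u. ?\<psi> (u + 1))"
        by (rule continuous_on_compose2[OF \<psi>(2)]) (auto intro!: continuous_intros)
      show "p (\<gamma> (?\<psi> u)) = p (?\<psi> (u + 1))" if "u \<in> upper_half_plane" for u
        using that \<gamma>'(3)[of "?\<psi> u"] \<psi>(1) shift[OF that] by (auto simp: Pi_iff)
      show "(\<lambda>u. \<gamma> (?\<psi> u)) \<in> upper_half_plane \<rightarrow> Ct" "(\<lambda>u. ?\<psi> (u + 1)) \<in> upper_half_plane \<rightarrow> Ct"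
        using \<psi>(1) \<gamma>'(2) by (auto simp: Pi_iff)
    qed (use \<gamma>(2) u in auto)
    \<comment> \<open>The exponent is \<open>n + 1\<close> because the n-th filtration step is cut
      out by that power of the augmentation ideal.\<close>
    have "group_algebra_act Ct f (group_algebra_diff_power ?G \<gamma> (n + 1)) = (\<lambda>x\<in>Ct. 0)"
      using f group_algebra_diff_power_in_ideal_power[OF group_deck_group \<gamma>(1), of "n + 1"]
      unfolding filtration_moderate_def by blast
    moreover have "(shift_diff ^^ (n + 1)) (pullback upper_half_plane ?\<psi> f) =
        pullback upper_half_plane ?\<psi> (group_algebra_act Ct f (group_algebra_diff_power ?G \<gamma> (n + 1)))"
      using \<psi>(1)
      by (intro act_diff_power_eq_shift_diff[OF group_deck_group \<gamma>(1) deck_mult_apply[OF _ \<gamma>(1)] deck_one_apply \<gamma>'(2)] \<gamma>\<psi>)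
         (auto simp: Pi_iff)
    ultimately have "(shift_diff ^^ (n + 1)) (pullback upper_half_plane ?\<psi> f) = (\<lambda>u\<in>upper_half_plane. 0)"
      using \<psi>(1) by (auto simp: pullback_def fun_eq_iff Pi_iff)
    moreover have "pullback upper_half_plane ?\<psi> f \<in> moderate_half_plane_funs"
      using f s x by (auto simp: filtration_moderate_def moderate_funs_def)
    ultimately show ?thesis by (intro shift_nilpotent_moderate_in_log_disc_funs)
  qed
  then show ?thesis
    by (auto simp: filtration_moderate_infinity_def puncture_pullback_def)
qed

end
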